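(* Algorithm 1 (the branching algorithm described in the context) solves \textsc{PVC} in time $O^*(1.274^P)$; that is, given an instance of \textsc{PVC} and an integer $P$, it determines within this time whether there exists a feasible solution of total power at most $P$.
   Context: \textsc{Power Vertex Cover (PVC)}: the input is a finite simple undirected graph $G=(V,E)$ with a positive integer weight $w_e$ on each edge $e\in E$ (also written $w_{u,v}$ if $e=(u,v)$). A feasible solution assigns to each vertex $v\in V$ a value (power) $p_v\ge 0$ such that for every edge $e=(u,v)$ we have $p_u\ge w_e$ or $p_v\ge w_e$. Its total power is $\sum_{v\in V}p_v$. \textsc{Vertex Cover (VC)} is the case where all weights are $1$; an algorithm is known that decides in time $O^*(1.274^k)$ whether a graph has a vertex cover of size at most $k$. The notation $O^*$ hides factors polynomial in the input size. Reduction rule (RR1): suppose that there is an edge $(u,v)$ with $w_{u,v}=M$, and the maximum weight of the other edges incident to $u$ or $v$ is $B\le M-1$ (with $B=0$ if there are no such edges). Then set $w_{u,v}=B$ (an edge of weight $0$ is removed) and do $P\leftarrow P-(M-B)$. Algorithm 1 (recursive, on a weighted graph and an integer $P$; after a branching the answer is YES iff at least one branch answers YES). Step 1: while (RR1) is applicable, apply it. Step 2: if $P<0$ return NO; if the graph has no edge return YES. Step 3: if the maximum weight of edges is $1$, apply an $O^*(1.274^k)$-time algorithm for \textsc{VC} (with $k=P$). Step 4: take two adjacent edges $e=(u,v)$ and $f=(u,v')$ of maximum weight, and branch as follows: either set $p_u=w_e$ (remove $u$ and its incident edges, set $P\leftarrow P-w_e$), or set $p_v=p_{v'}=w_e$ (remove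 $v$ and $v'$ and their incident edges, set $P\leftarrow P-2w_e$). *)

theory Defs
  imports Complex_Main "HOL-Library.Log_Nat" "HOL-Computational_Algebra.Polynomial"
begin

definition simple_graph :: "'a set \<Rightarrow> 'a set set \<Rightarrow> bool" where
  "simple_graph V E \<longleftrightarrow> finite V \<and> (\<forall>e\<in>E. \<exists>u v. u \<in> V \<and> v \<in> V \<and> u \<noteq> v \<and> e = {u, v})"

definition pvc_instance :: "'a set \<Rightarrow> 'a set set \<Rightarrow> ('a set \<Rightarrow> nat) \<Rightarrow> bool" where
  "pvc_instance V E w \<longleftrightarrow> simple_graph V E \<and> (\<forall>e\<in>E. 0 < w e)"

definition pvc_feasible :: "'a set \<Rightarrow> 'a set set \<Rightarrow> ('a set \<Rightarrow> nat) \<Rightarrow> ('a \<Rightarrow> real) \<Rightarrow> bool" where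
  "pvc_feasible V E w p \<longleftrightarrow>
     (\<forall>v\<in>V. 0 \<le> p v) \<and>
     (\<forall>u v. {u, v} \<in> E \<longrightarrow> real (w {u, v}) \<le> p u \<or> real (w {u, v}) \<le> p v)"

definition pvc_solvable :: "'a set \<Rightarrow> 'a set set \<Rightarrow> ('a set \<Rightarrow> nat) \<Rightarrow> int \<Rightarrow> bool" where
  "pvc_solvable V E w P \<longleftrightarrow>
     (\<exists>p. pvc_feasible V E w p \<and> (\<Sum>v\<in>V. p v) \<le> real_of_int P)"

definition vertex_cover :: "'a set \<Rightarrow> 'a set set \<Rightarrow> 'a set \<Rightarrow> bool" where
  "vertex_cover V E C \<longleftrightarrow> C \<subseteq> V \<and> (\<forall>e\<in>E. e \<inter> C \<noteq> {})"

text \<open>A graph is given to an algorithm as a list of vertices and a list of edges, in any order;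
  each edge is listed once, with its end points in any order.\<close>

type_synonym 'a edge_list = "('a \<times> 'a) list"
type_synonym 'a wedge_list = "('a \<times> 'a \<times> nat) list"

definition encodes_graph :: "'a list \<times> 'a edge_list \<Rightarrow> 'a set \<Rightarrow> 'a set set \<Rightarrow> bool" where
  "encodes_graph G V E \<longleftrightarrow> (case G of (vs, es) \<Rightarrow>
     distinct vs \<and> set vs = V \<and>
     distinct (map (\<lambda>(u, v). {u, v}) es) \<and> (\<lambda>(u, v). {u, v}) ` set es = E)"

definition encodes_wgraph ::
    "'a list \<times> 'a wedge_list \<Rightarrow> 'a set \<Rightarrow> 'a set set \<Rightarrow> ('a set \<Rightarrow> nat) \<Rightarrow> bool" where
  "encodes_wgraph G V E w \<longleftrightarrow> (case G of (vs, es) \<Rightarrow>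
     encodes_graph (vs, map (\<lambda>(u, v, c). (u, v)) es) V E \<and>
     (\<forall>(u, v, c)\<in>set es. c = w {u, v}))"

text \<open>Numbers are written in binary; vertex names count as one unit each.\<close>

abbreviation bits :: "nat \<Rightarrow> nat" where
  "bits n \<equiv> floorlog 2 n"

abbreviation ibits :: "int \<Rightarrow> nat" where
  "ibits i \<equiv> bits (nat \<bar>i\<bar>)"

definition vc_size :: "'a set \<Rightarrow> 'a set set \<Rightarrow> nat \<Rightarrow> nat" where
  "vc_size V E k = card V + card E + bits k"

definition pvc_size :: "'a set \<Rightarrow> 'a set set \<Rightarrow> ('a set \<Rightarrow> nat) \<Rightarrow> int \<Rightarrow> nat" where
  "pvc_size V E w P = card V + card E + (\<Sum>e\<in>E. bits (w e)) + ibits P"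

text \<open>The subroutine returns its answer together with the number of steps it has used.\<close>

type_synonym 'a vc_algorithm = "'a list \<times> 'a edge_list \<Rightarrow> nat \<Rightarrow> bool \<times> nat"

definition decides_vc :: "'a vc_algorithm \<Rightarrow> bool" where
  "decides_vc vc \<longleftrightarrow> (\<forall>V E G k. simple_graph V E \<longrightarrow> encodes_graph G V E \<longrightarrow>
     (fst (vc G k) \<longleftrightarrow> (\<exists>C. vertex_cover V E C \<and> card C \<le> k)))"

definition vc_time_Ostar :: "real \<Rightarrow> 'a vc_algorithm \<Rightarrow> bool" where
  "vc_time_Ostar b vc \<longleftrightarrow> (\<exists>q :: real poly.
     \<forall>V E G k. simple_graph V E \<longrightarrow> encodes_graph G V E \<longrightarrow>
       real (snd (vc G k)) \<le> poly q (real (vc_size V E k)) * b ^ k)"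

text \<open>A terminating computation is \<open>Some (x, t)\<close>, with result \<open>x\<close> after \<open>t\<close> steps; \<open>None\<close> stands
  for divergence. Primitive operations are introduced by \<open>charge\<close>: an equality test between
  vertices, a list constructor, or a test for the empty list or the sign of a number costs one
  step; any other operation on numbers costs one plus the total length of its operands.\<close>

type_synonym 'b timed = "('b \<times> nat) option"

definition charge :: "nat \<Rightarrow> 'b \<Rightarrow> 'b timed" where
  "charge t x = Some (x, t)"

definition run_then :: "'b timed \<Rightarrow> ('b \<Rightarrow> 'c timed) \<Rightarrow> 'c timed" (infixr \<open>\<triangleright>\<close> 60) where
  "m \<triangleright> f = Option.bind m (\<lambda>(x, s). Option.bind (f x) (\<lambda>(y, t). Some (y, s + t)))"

lemma run_then_mono [partial_function_mono]:
  assumes "mono_option B" and "\<And>y. mono_option (\<lambda>f. C y f)"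
  shows "mono_option (\<lambda>f. B f \<triangleright> (\<lambda>y. C y f))"
  unfolding run_then_def case_prod_beta
  by (intro bind_mono assms option.const_mono)

text \<open>The maximum weight of the edges other than \<open>{u, v}\<close> that are incident to \<open>u\<close> or \<open>v\<close>
  (\<open>0\<close> if there are none).\<close>

fun max_other :: "'a \<Rightarrow> 'a \<Rightarrow> 'a wedge_list \<Rightarrow> nat timed" where
  "max_other u v [] = charge 1 0"
| "max_other u v ((x, y, c) # es) =
     max_other u v es \<triangleright> (\<lambda>B.
     charge 4 ({x, y} \<noteq> {u, v} \<and> {x, y} \<inter> {u, v} \<noteq> {}) \<triangleright> (\<lambda>other.
     if other then charge (1 + bits B + bits c) (max B c) else charge 1 B))"

text \<open>All applications \<open>(u, v, M, B)\<close> of the reduction rule to an edge of the second list, in the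
  graph given by the first list.\<close>

fun reductions :: "'a wedge_list \<Rightarrow> 'a wedge_list \<Rightarrow> ('a \<times> 'a \<times> nat \<times> nat) list timed" where
  "reductions all [] = charge 1 []"
| "reductions all ((u, v, M) # es) =
     reductions all es \<triangleright> (\<lambda>rs.
     max_other u v all \<triangleright> (\<lambda>B.
     charge (1 + bits B + bits M) (B < M) \<triangleright> (\<lambda>applicable.
     charge 1 (if applicable then (u, v, M, B) # rs else rs))))"

fun set_weight :: "'a \<Rightarrow> 'a \<Rightarrow> nat \<Rightarrow> 'a wedge_list \<Rightarrow> 'a wedge_list timed" where
  "set_weight u v B [] = charge 1 []"
| "set_weight u v B ((x, y, c) # es) =
     set_weight u v B es \<triangleright> (\<lambda>es'.
     charge 4 ({x, y} = {u, v}) \<triangleright> (\<lambda>same.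
     charge 2 (if same then (if B = 0 then es' else (x, y, B) # es') else (x, y, c) # es')))"

definition subtract :: "int \<Rightarrow> nat \<Rightarrow> int timed" where
  "subtract P d = charge (1 + ibits P + bits d) (P - int d)"

text \<open>The rule \<open>pick\<close> settles which of the applicable reductions is performed; selecting from a
  list is charged the length of the list.\<close>

partial_function (option) reduce ::
    "(('a \<times> 'a \<times> nat \<times> nat) list \<Rightarrow> 'a \<times> 'a \<times> nat \<times> nat) \<Rightarrow> 'a wedge_list \<Rightarrow> int \<Rightarrow>
     ('a wedge_list \<times> int) timed" where
  "reduce pick es P =
     reductions es es \<triangleright> (\<lambda>rs.
     charge 1 (rs = []) \<triangleright> (\<lambda>irreducible.
     if irreducible then charge 1 (es, P)
     else
       charge (1 + length rs) (pick rs) \<triangleright> (\<lambda>(u, v, M, B).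
       set_weight u v B es \<triangleright> (\<lambda>es'.
       charge (1 + bits M + bits B) (M - B) \<triangleright> (\<lambda>d.
       subtract P d \<triangleright> (\<lambda>P'.
       reduce pick es' P'))))))"

fun max_weight :: "'a wedge_list \<Rightarrow> nat timed" where
  "max_weight [] = charge 1 0"
| "max_weight ((x, y, c) # es) =
     max_weight es \<triangleright> (\<lambda>W. charge (1 + bits W + bits c) (max W c))"

fun forget_weights :: "'a wedge_list \<Rightarrow> 'a edge_list timed" where
  "forget_weights [] = charge 1 []"
| "forget_weights ((x, y, c) # es) =
     forget_weights es \<triangleright> (\<lambda>es'. charge 1 ((x, y) # es'))"

fun heaviest :: "nat \<Rightarrow> 'a wedge_list \<Rightarrow> 'a edge_list timed" where
  "heaviest W [] = charge 1 []"
| "heaviest W ((x, y, c) # es) =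
     heaviest W es \<triangleright> (\<lambda>es'.
     charge (1 + bits W + bits c) (c = W) \<triangleright> (\<lambda>heavy.
     charge 1 (if heavy then (x, y) # es' else es')))"

text \<open>The triples \<open>(u, v, v')\<close> such that \<open>{u, v}\<close> is the given edge \<open>{x, y}\<close>, \<open>{u, v'}\<close> is an edge
  of the list, and \<open>v \<noteq> v'\<close>.\<close>

fun forks_at :: "'a \<Rightarrow> 'a \<Rightarrow> 'a edge_list \<Rightarrow> ('a \<times> 'a \<times> 'a) list timed" where
  "forks_at x y [] = charge 1 []"
| "forks_at x y ((a, b) # es) =
     forks_at x y es \<triangleright> (\<lambda>fs.
     charge 5
       (if x = a \<and> y \<noteq> b then (x, y, b) # fs
        else if x = b \<and> y \<noteq> a then (x, y, a) # fs
        else if y = a \<and> x \<noteq> b then (y, x, b) # fs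
        else if y = b \<and> x \<noteq> a then (y, x, a) # fs
        else fs))"

fun forks :: "'a edge_list \<Rightarrow> 'a edge_list \<Rightarrow> ('a \<times> 'a \<times> 'a) list timed" where
  "forks all [] = charge 1 []"
| "forks all ((x, y) # es) =
     forks all es \<triangleright> (\<lambda>fs.
     forks_at x y all \<triangleright> (\<lambda>fs'.
     charge (1 + length fs') (fs' @ fs)))"

fun delete_from_vertices :: "'a \<Rightarrow> 'a list \<Rightarrow> 'a list timed" where
  "delete_from_vertices u [] = charge 1 []"
| "delete_from_vertices u (x # vs) =
     delete_from_vertices u vs \<triangleright> (\<lambda>vs'. charge 2 (if x = u then vs' else x # vs'))"

fun delete_from_edges :: "'a \<Rightarrow> 'a wedge_list \<Rightarrow> 'a wedge_list timed" where
  "delete_from_edges u [] = charge 1 []"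
| "delete_from_edges u ((x, y, c) # es) =
     delete_from_edges u es \<triangleright> (\<lambda>es'.
     charge 3 (if x = u \<or> y = u then es' else (x, y, c) # es'))"

definition delete_vertex ::
    "'a \<Rightarrow> 'a list \<times> 'a wedge_list \<Rightarrow> ('a list \<times> 'a wedge_list) timed" where
  "delete_vertex u G = (case G of (vs, es) \<Rightarrow>
     delete_from_vertices u vs \<triangleright> (\<lambda>vs'.
     delete_from_edges u es \<triangleright> (\<lambda>es'. charge 1 (vs', es'))))"

definition call_vc :: "'a vc_algorithm \<Rightarrow> 'a list \<times> 'a wedge_list \<Rightarrow> int \<Rightarrow> bool timed" where
  "call_vc vc G P = (case G of (vs, es) \<Rightarrow>
     forget_weights es \<triangleright> (\<lambda>es'.
     charge (1 + ibits P) (nat P) \<triangleright> (\<lambda>k. Some (vc (vs, es') k))))"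

partial_function (option) pvc_branching ::
    "'a vc_algorithm \<Rightarrow>
     (('a \<times> 'a \<times> nat \<times> nat) list \<Rightarrow> 'a \<times> 'a \<times> nat \<times> nat) \<Rightarrow>
     (('a \<times> 'a \<times> 'a) list \<Rightarrow> 'a \<times> 'a \<times> 'a) \<Rightarrow>
     'a list \<times> 'a wedge_list \<Rightarrow> int \<Rightarrow> bool timed" where
  "pvc_branching vc pick_reduction pick_fork G P0 =
     reduce pick_reduction (snd G) P0 \<triangleright> (\<lambda>(es, P).
     charge 1 (P < 0) \<triangleright> (\<lambda>negative.
     if negative then charge 1 False
     else
       charge 1 (es = []) \<triangleright> (\<lambda>edgeless.
       if edgeless then charge 1 True
       else
         max_weight es \<triangleright> (\<lambda>W.
         charge (2 + bits W) (W = 1) \<triangleright> (\<lambda>unweighted.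
         if unweighted then call_vc vc (fst G, es) P
         else
           heaviest W es \<triangleright> (\<lambda>hs.
           forks hs hs \<triangleright> (\<lambda>fs.
           charge (1 + length fs) (pick_fork fs) \<triangleright> (\<lambda>(u, v, v').
           delete_vertex u (fst G, es) \<triangleright> (\<lambda>G1.
           subtract P W \<triangleright> (\<lambda>P1.
           pvc_branching vc pick_reduction pick_fork G1 P1 \<triangleright> (\<lambda>ans1.
           delete_vertex v (fst G, es) \<triangleright> (\<lambda>G'.
           delete_vertex v' G' \<triangleright> (\<lambda>G2.
           charge (1 + bits W) (2 * W) \<triangleright> (\<lambda>WW.
           subtract P WW \<triangleright> (\<lambda>P2.
           pvc_branching vc pick_reduction pick_fork G2 P2 \<triangleright> (\<lambda>ans2.
           charge 1 (ans1 \<or> ans2)))))))))))))))))"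

definition valid_pick :: "('b list \<Rightarrow> 'b) \<Rightarrow> bool" where
  "valid_pick pick \<longleftrightarrow> (\<forall>xs. xs \<noteq> [] \<longrightarrow> pick xs \<in> set xs)"

end

theory Submission
  imports Defs
begin

text \<open>Both rules are safe. Of a feasible solution one may lower the end point paying for the strictly
  heaviest edge \<open>uv\<close> of a neighbourhood to the next weight \<open>B\<close>, and conversely raise it again; and
  for two adjacent edges \<open>uv\<close>, \<open>uv'\<close> of maximum weight \<open>W\<close> either \<open>u\<close> or both \<open>v\<close> and \<open>v'\<close> have power
  at least \<open>W\<close>. For the running time, an edge lowered by the reduction rule is afterwards tied with a
  neighbour and never reducible again, so there are at most \<open>|E|\<close> reductions at each node; branching
  happens only for \<open>W \<ge> 2\<close> and hence lowers the budget by at least \<open>2\<close> or \<open>4\<close>, where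
  \<open>1.274 ^ -2 + 1.274 ^ -4 < 1\<close>. The budget minus the total weight never decreases along the
  recursion, so the numbers stay polynomially long.\<close>

section \<open>A calculus of time bounds for timed computations\<close>

text \<open>Total correctness with a budget: a divergent computation satisfies no such statement.
  The budget is real so that it can be subtracted from and compared with polynomials and powers of
  \<open>1.274\<close>.\<close>

definition runs_within :: "'b timed \<Rightarrow> real \<Rightarrow> ('b \<Rightarrow> bool) \<Rightarrow> bool" where
  "runs_within m T Q \<longleftrightarrow> (\<exists>x t. m = Some (x, t) \<and> real t \<le> T \<and> Q x)"

lemma runs_within_charge: "real t \<le> T \<Longrightarrow> Q x \<Longrightarrow> runs_within (charge t x) T Q"
  by (simp add: runs_within_def charge_def)

text \<open>The continuation receives what is left of the budget, \<open>T - S\<close>. Following a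
  program backwards thus only accumulates subtractions, and the arithmetic is settled once, at the
  last operation.\<close>

lemma runs_within_run_then:
  assumes "runs_within m S Q" and "\<And>x. Q x \<Longrightarrow> runs_within (f x) (T - S) R"
  shows "runs_within (m \<triangleright> f) T R"
proof -
  obtain x s where x: "m = Some (x, s)" "real s \<le> S" "Q x"
    using assms(1) by (auto simp: runs_within_def)
  obtain y t where "f x = Some (y, t)" "real t \<le> T - S" "R y"
    using assms(2)[OF x(3)] by (auto simp: runs_within_def)
  with x show ?thesis
    by (auto simp: runs_within_def run_then_def)
qed

lemma runs_within_charge_then:
  "runs_within (f x) (T - real t) R \<Longrightarrow> runs_within (charge t x \<triangleright> f) T R"
  by (rule runs_within_run_then[where Q = "\<lambda>y. y = x" and S = "real t"]) (auto intro: runs_within_charge)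

lemma runs_within_mono: "runs_within m S Q \<Longrightarrow> S \<le> T \<Longrightarrow> runs_within m T Q"
  by (force simp: runs_within_def)

lemma runs_within_weaken: "runs_within m S Q \<Longrightarrow> S \<le> T \<Longrightarrow> (\<And>x. Q x \<Longrightarrow> R x) \<Longrightarrow> runs_within m T R"
  by (force simp: runs_within_def)

lemma bits_0 [simp]: "bits 0 = 0"
  by (simp add: floorlog_def)

lemma bits_le: "n < 2 ^ b \<Longrightarrow> bits n \<le> b"
  by (simp add: floorlog_leI)

lemma less_two_power_bits: "n < 2 ^ bits n"
  using floorlog_bounds[of n 2] by (cases "n = 0") auto

section \<open>Weighted edge lists, their feasibility and the length of their numbers\<close>

definition adjacent :: "'a set \<Rightarrow> 'a set \<Rightarrow> bool" where
  "adjacent e f \<longleftrightarrow> e \<noteq> f \<and> e \<inter> f \<noteq> {}"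

abbreviation ends :: "'a \<times> 'a \<times> nat \<Rightarrow> 'a set" where
  "ends \<equiv> \<lambda>(x, y, c). {x, y}"

definition wf_edges :: "'a set \<Rightarrow> 'a wedge_list \<Rightarrow> bool" where
  "wf_edges V es \<longleftrightarrow> distinct (map ends es) \<and>
     (\<forall>(x, y, c)\<in>set es. x \<in> V \<and> y \<in> V \<and> x \<noteq> y \<and> 0 < c)"

text \<open>Weights are read off the triples rather than from a fixed weight function, because the
  reduction rule changes them during the run.\<close>

definition solvable_list :: "'a set \<Rightarrow> 'a wedge_list \<Rightarrow> int \<Rightarrow> bool" where
  "solvable_list V es P \<longleftrightarrow> (\<exists>p :: 'a \<Rightarrow> real. (\<forall>v\<in>V. 0 \<le> p v) \<and>
     (\<forall>(x, y, c)\<in>set es. real c \<le> p x \<or> real c \<le> p y) \<and> sum p V \<le> real_of_int P)"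

definition total :: "'a wedge_list \<Rightarrow> nat" where
  "total es = (\<Sum>(x, y, c)\<leftarrow>es. c)"

text \<open>The invariant that keeps every number within \<open>b\<close> bits. The budget itself
  may fall below zero, so its lower bound is stated for \<open>P - total es\<close>: whatever the
  algorithm takes from \<open>P\<close>, it takes at least as much from the total weight.\<close>

definition bounded :: "nat \<Rightarrow> 'a wedge_list \<Rightarrow> int \<Rightarrow> bool" where
  "bounded b es P \<longleftrightarrow> total es < 2 ^ b \<and> P < 2 ^ b \<and> - (2 ^ b) < P - int (total es)"

lemma weight_le_total: "(x, y, c) \<in> set es \<Longrightarrow> c \<le> total es"
  unfolding total_def by (rule member_le_sum_list) force+

lemma bounded_bits_weight: "bounded b es P \<Longrightarrow> (x, y, c) \<in> set es \<Longrightarrow> bits c \<le> b"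
  using weight_le_total[of x y c es] by (intro bits_le) (auto simp: bounded_def)

lemma bounded_ibits: "bounded b es P \<Longrightarrow> ibits P \<le> b"
  by (intro bits_le) (auto simp: bounded_def nat_less_iff)

lemma bounded_mono:
  "bounded b es P \<Longrightarrow> P' \<le> P \<Longrightarrow> total es' \<le> total es \<Longrightarrow>
   P - int (total es) \<le> P' - int (total es') \<Longrightarrow> bounded b es' P'"
  by (auto simp: bounded_def)

lemma wf_edges_unique:
  "wf_edges V es \<Longrightarrow> (x, y, c) \<in> set es \<Longrightarrow> (x', y', c') \<in> set es \<Longrightarrow> {x, y} = {x', y'} \<Longrightarrow>
   x' = x \<and> y' = y \<and> c' = c"
  unfolding wf_edges_def distinct_map inj_on_def by fastforce

subsection \<open>The reduction rule\<close>

text \<open>The disjunct \<open>B = 0\<close> is the default for an edge without neighbours; as soon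
  as all weights are positive, the first conjunct permits it only there.\<close>

definition max_adjacent :: "'a \<Rightarrow> 'a \<Rightarrow> 'a wedge_list \<Rightarrow> nat \<Rightarrow> bool" where
  "max_adjacent u v es B \<longleftrightarrow>
     (\<forall>x y c. (x, y, c) \<in> set es \<longrightarrow> adjacent {x, y} {u, v} \<longrightarrow> c \<le> B) \<and>
     (B = 0 \<or> (\<exists>x y. (x, y, B) \<in> set es \<and> adjacent {x, y} {u, v}))"

lemma max_adjacent_Cons:
  assumes "max_adjacent u v es B"
  shows "max_adjacent u v ((x, y, c) # es) (if adjacent {x, y} {u, v} then max B c else B)"
proof (cases "adjacent {x, y} {u, v}")
  case True
  show ?thesis
  proof (cases "c \<le> B")
    case True
    with assms show ?thesis by (auto simp: max_adjacent_def)
  next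
    case False
    then have m: "max B c = c" by simp
    have "c' \<le> c" if "(x', y', c') \<in> set es" "adjacent {x', y'} {u, v}" for x' y' c'
      using that assms False unfolding max_adjacent_def by (meson le_trans nat_le_linear)
    with True show ?thesis unfolding max_adjacent_def m by auto
  qed
next
  case False
  with assms show ?thesis by (auto simp: max_adjacent_def)
qed

lemma runs_within_max_other:
  assumes "\<forall>(x, y, c)\<in>set es. bits c \<le> b"
  shows "runs_within (max_other u v es) (1 + real (length es) * (5 + 2 * real b)) (max_adjacent u v es)"
  using assms
proof (induction es)
  case Nil
  show ?case by (auto intro!: runs_within_charge simp: max_adjacent_def)
next
  case (Cons e es)
  obtain x y c where e: "e = (x, y, c)" by (cases e)
  have IH: "runs_within (max_other u v es) (1 + real (length es) * (5 + 2 * real b)) (max_adjacent u v es)"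
    using Cons by simp
  have c: "bits c \<le> b" using Cons.prems by (simp add: e)
  show ?case unfolding e max_other.simps
  proof (rule runs_within_run_then[OF IH], rule runs_within_charge_then)
    fix B assume B: "max_adjacent u v es B"
    \<comment> \<open>\<open>B\<close> is either \<open>0\<close> or a weight of the list, so it is
      no longer than the listed numbers.\<close>
    have "bits B \<le> b"
      using B Cons.prems by (auto simp: max_adjacent_def)
    with B c show "runs_within (if {x, y} \<noteq> {u, v} \<and> {x, y} \<inter> {u, v} \<noteq> {}
        then charge (1 + bits B + bits c) (max B c) else charge 1 B)
        (1 + real (length ((x, y, c) # es)) * (5 + 2 * real b) -
         (1 + real (length es) * (5 + 2 * real b)) - real 4)
        (max_adjacent u v ((x, y, c) # es))"
      unfolding adjacent_def[symmetric]
      using max_adjacent_Cons[OF B, of x y c] by (auto intro!: runs_within_charge simp: algebra_simps)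
  qed
qed

text \<open>The length bound pays for the selection, the middle conjunct makes every choice from the
  list a legal application of the rule, and the last one describes the graph on exit: no edge is
  strictly heavier than all its neighbours.\<close>

lemma runs_within_reductions:
  assumes "\<forall>(x, y, c)\<in>set all. bits c \<le> b" and "set es \<subseteq> set all"
  shows "runs_within (reductions all es)
     (1 + real (length es) * (3 + 2 * real b + real (length all) * (5 + 2 * real b)))
     (\<lambda>rs. length rs \<le> length es \<and>
        (\<forall>(u, v, M, B)\<in>set rs. (u, v, M) \<in> set es \<and> max_adjacent u v all B \<and> B < M) \<and>
        (rs = [] \<longrightarrow> (\<forall>(u, v, M)\<in>set es. \<exists>B\<ge>M. max_adjacent u v all B)))"
    (is "runs_within _ (?T es) (?Q es)")
  using assms(2)
proof (induction es)
  case Nil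
  show ?case by (auto intro!: runs_within_charge)
next
  case (Cons e es)
  obtain u v M where e: "e = (u, v, M)" by (cases e)
  have IH: "runs_within (reductions all es) (?T es) (?Q es)"
    using Cons by simp
  have c: "bits M \<le> b" using Cons.prems assms(1) by (auto simp: e)
  show ?case unfolding e reductions.simps
  proof (rule runs_within_run_then[OF IH], rule runs_within_run_then[OF runs_within_max_other[OF assms(1)]],
      rule runs_within_charge_then)
    fix rs B assume rs: "?Q es rs" and B: "max_adjacent u v all B"
    have bB: "bits B \<le> b"
      using B assms(1) by (auto simp: max_adjacent_def)
    show "runs_within (charge 1 (if B < M then (u, v, M, B) # rs else rs))
       (?T ((u, v, M) # es) - ?T es - (1 + real (length all) * (5 + 2 * real b))
         - real (1 + bits B + bits M)) (?Q ((u, v, M) # es))"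
    proof (rule runs_within_charge)
      show "?Q ((u, v, M) # es) (if B < M then (u, v, M, B) # rs else rs)"
        using rs B by (auto simp: not_less)
      show "real 1 \<le> ?T ((u, v, M) # es) - ?T es - (1 + real (length all) * (5 + 2 * real b))
         - real (1 + bits B + bits M)"
        using c bB by (simp add: algebra_simps)
    qed
  qed
qed

definition reweigh :: "'a \<Rightarrow> 'a \<Rightarrow> nat \<Rightarrow> 'a wedge_list \<Rightarrow> 'a wedge_list" where
  "reweigh u v B es = (if B = 0 then filter (\<lambda>e. ends e \<noteq> {u, v}) es
     else map (\<lambda>(x, y, c). (x, y, if {x, y} = {u, v} then B else c)) es)"

lemma reweigh_simps [simp]:
  "reweigh u v B [] = []"
  "reweigh u v B ((x, y, c) # es) =
     (if {x, y} = {u, v} then (if B = 0 then reweigh u v B es else (x, y, B) # reweigh u v B es)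
      else (x, y, c) # reweigh u v B es)"
  by (auto simp: reweigh_def)

lemma set_weight_eq: "set_weight u v B es = Some (reweigh u v B es, 1 + 6 * length es)"
proof (induction es)
  case Nil
  show ?case by (simp add: charge_def)
next
  case (Cons e es)
  then show ?case by (cases e) (simp add: charge_def run_then_def)
qed

lemma set_reweigh:
  "(x, y, c) \<in> set (reweigh u v B es) \<longleftrightarrow>
     (if {x, y} = {u, v} then c = B \<and> 0 < B \<and> (\<exists>c'. (x, y, c') \<in> set es) else (x, y, c) \<in> set es)"
  by (induction es) (auto split: if_splits)

lemma length_reweigh_le: "length (reweigh u v B es) \<le> length es"
  by (simp add: reweigh_def)

lemma reweigh_idle: "{u, v} \<notin> ends ` set es \<Longrightarrow> reweigh u v B es = es"
proof (induction es)
  case (Cons e es)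
  obtain x y c where "e = (x, y, c)" by (cases e)
  with Cons show ?case by auto
qed simp

lemma wf_edges_reweigh: "wf_edges V es \<Longrightarrow> wf_edges V (reweigh u v B es)"
proof -
  assume wf: "wf_edges V es"
  have "distinct (map ends (reweigh u v B es))"
  proof (cases "B = 0")
    case True
    with wf show ?thesis by (simp add: reweigh_def wf_edges_def distinct_map_filter)
  next
    case False
    have "map ends (map (\<lambda>(x, y, c). (x, y, if {x, y} = {u, v} then B else c)) es) = map ends es"
      by auto
    with wf False show ?thesis unfolding reweigh_def wf_edges_def by presburger
  qed
  with wf show ?thesis
    by (fastforce simp: wf_edges_def set_reweigh split: if_splits)
qed

text \<open>Written with sums to avoid truncated subtraction. For \<open>B < M\<close> the total
  drops by exactly the amount that the rule takes from the budget.\<close>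

lemma total_reweigh:
  "distinct (map ends es) \<Longrightarrow> (u, v, M) \<in> set es \<Longrightarrow> total (reweigh u v B es) + M = total es + B"
proof (induction es)
  case Nil
  then show ?case by simp
next
  case (Cons e es)
  obtain x y c where e: "e = (x, y, c)" by (cases e)
  show ?case
  proof (cases "{x, y} = {u, v}")
    case True
    have nin: "{u, v} \<notin> ends ` set es"
      using Cons.prems(1) True by (auto simp: e)
    have "(u, v, M) \<notin> set es" using nin by force
    then have "x = u" "y = v" "c = M" using Cons.prems(2) by (auto simp: e)
    then show ?thesis
      by (simp add: e reweigh_idle[OF nin] total_def)
  next
    case False
    then have "(u, v, M) \<in> set es" using Cons.prems(2) by (auto simp: e)
    with Cons False show ?thesis by (auto simp: e total_def)
  qed
qed

text \<open>A single end point \<open>a\<close> of the edge carries the whole change of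
  \<open>M - B\<close>. Raised from at least \<open>B\<close>, it pays for the edge at its old
  weight; lowered from at least \<open>M\<close>, it keeps at least \<open>B\<close>, which still
  covers the edge and every other edge at \<open>a\<close>.\<close>

lemma solvable_reweigh:
  assumes V: "finite V" and wf: "wf_edges V es" and e: "(u, v, M) \<in> set es"
    and B: "max_adjacent u v es B" "B < M"
  shows "solvable_list V (reweigh u v B es) (P - int (M - B)) \<longleftrightarrow> solvable_list V es P"
proof
  have uv: "u \<in> V" "v \<in> V" "u \<noteq> v" using wf e by (auto simp: wf_edges_def)
  have low: "c \<le> B" if "(x, y, c) \<in> set es" "{x, y} \<noteq> {u, v}" "{x, y} \<inter> {u, v} \<noteq> {}" for x y c
    using B(1) that by (auto simp: max_adjacent_def adjacent_def)
  {
    assume "solvable_list V (reweigh u v B es) (P - int (M - B))"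
    then obtain p :: "'a \<Rightarrow> real" where p: "\<forall>v\<in>V. 0 \<le> p v"
      "\<And>x y c. (x, y, c) \<in> set (reweigh u v B es) \<Longrightarrow> real c \<le> p x \<or> real c \<le> p y"
      "sum p V \<le> real_of_int (P - int (M - B))"
      unfolding solvable_list_def by blast
    have "real B \<le> p u \<or> real B \<le> p v"
    \<comment> \<open>For \<open>B = 0\<close> the edge is missing from the new list, and the bound
      comes from the powers being nonnegative.\<close>
    proof (cases "B = 0")
      case True
      then show ?thesis using p(1) uv by auto
    next
      case False
      then have "(u, v, B) \<in> set (reweigh u v B es)" using e by (auto simp: set_reweigh)
      then show ?thesis by (rule p(2))
    qed
    then obtain a where a: "a \<in> {u, v}" "real B \<le> p a" by auto
    define p' where "p' = p(a := p a + real (M - B))"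
    have "sum p' V = sum p V + real (M - B)"
    proof -
      have "sum p' V = p' a + sum p' (V - {a})" using V a uv by (auto intro: sum.remove)
      also have "sum p' (V - {a}) = sum p (V - {a})" by (rule sum.cong) (auto simp: p'_def)
      finally show ?thesis using sum.remove[OF V, of a p] a uv by (auto simp: p'_def)
    qed
    moreover have "real c \<le> p' x \<or> real c \<le> p' y" if "(x, y, c) \<in> set es" for x y c
    proof (cases "{x, y} = {u, v}")
      case True
      then have "c = M" using wf_edges_unique[OF wf e that] by simp
      moreover have "real M \<le> p' a" using a(2) B(2) by (simp add: p'_def)
      moreover have "a = x \<or> a = y" using True a by auto
      ultimately show ?thesis by auto
    next
      case False
      then have "(x, y, c) \<in> set (reweigh u v B es)" using that by (simp add: set_reweigh)
      from p(2)[OF this] show ?thesis using B(2) by (auto simp: p'_def)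
    qed
    moreover have "\<forall>v\<in>V. 0 \<le> p' v" using p(1) by (auto simp: p'_def)
    ultimately show "solvable_list V es P" unfolding solvable_list_def using p(3)
      by (intro exI[of _ p']) auto
  }
  {
    assume "solvable_list V es P"
    then obtain p :: "'a \<Rightarrow> real" where p: "\<forall>v\<in>V. 0 \<le> p v"
      "\<And>x y c. (x, y, c) \<in> set es \<Longrightarrow> real c \<le> p x \<or> real c \<le> p y"
      "sum p V \<le> real_of_int P"
      unfolding solvable_list_def by blast
    obtain a where a: "a \<in> {u, v}" "real M \<le> p a" using p(2)[OF e] by auto
    define p' where "p' = p(a := p a - real (M - B))"
    have pa: "real B \<le> p' a" using a(2) B(2) by (simp add: p'_def of_nat_diff)
    have "sum p' V = sum p V - real (M - B)"
    proof -
      have "sum p' V = p' a + sum p' (V - {a})" using V a uv by (auto intro: sum.remove)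
      also have "sum p' (V - {a}) = sum p (V - {a})" by (rule sum.cong) (auto simp: p'_def)
      finally show ?thesis using sum.remove[OF V, of a p] a uv by (auto simp: p'_def)
    qed
    moreover have "real c \<le> p' x \<or> real c \<le> p' y" if "(x, y, c) \<in> set (reweigh u v B es)" for x y c
    proof (cases "{x, y} = {u, v}")
      case True
      then have "c = B" using that by (simp add: set_reweigh)
      moreover have "a = x \<or> a = y" using True a by auto
      ultimately show ?thesis using pa by auto
    next
      case False
      then have f: "(x, y, c) \<in> set es" using that by (simp add: set_reweigh)
      show ?thesis
      proof (cases "a = x \<or> a = y")
        case True
        then have "c \<le> B" using low[OF f False] a by auto
        with pa True show ?thesis by force
      next
        case False
        with p(2)[OF f] show ?thesis by (auto simp: p'_def)
      qed
    qed
    moreover have "0 \<le> p' v" if "v \<in> V" for v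
      using p(1) that pa by (cases "v = a") (auto simp: p'_def)
    ultimately show "solvable_list V (reweigh u v B es) (P - int (M - B))"
      unfolding solvable_list_def using p(3) by (intro exI[of _ p']) auto
  }
qed

text \<open>An edge that the rule has lowered to the weight of a neighbour is never lowered again: of two
  adjacent edges of equal weight neither is reducible. Hence the edges without such a neighbour
  count the remaining iterations.\<close>

definition untied :: "'a wedge_list \<Rightarrow> 'a set set" where
  "untied es = {{x, y} | x y. \<exists>c. (x, y, c) \<in> set es \<and>
     \<not> (\<exists>x' y'. (x', y', c) \<in> set es \<and> adjacent {x', y'} {x, y})}"

lemma untied_subset: "untied es \<subseteq> ends ` set es"
  by (force simp: untied_def)

lemma card_untied_le: "card (untied es) \<le> length es"
  using card_mono[OF _ untied_subset[of es]] card_image_le[of "set es" ends] card_length[of es]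
  by auto

text \<open>The edge \<open>{u, v}\<close> was untied since all its neighbours weigh at most
  \<open>B < M\<close>; afterwards it is deleted or tied to a neighbour of weight \<open>B\<close>.
  No edge becomes untied: losing a tie to \<open>{u, v}\<close> would need a neighbour of weight
  \<open>M\<close>, which exceeds the maximum \<open>B\<close>.\<close>

lemma untied_reweigh:
  assumes wf: "wf_edges V es" and e: "(u, v, M) \<in> set es"
    and B: "max_adjacent u v es B" "B < M"
  shows "untied (reweigh u v B es) \<subset> untied es"
proof
  have low: "c \<le> B" if "(x, y, c) \<in> set es" "adjacent {x, y} {u, v}" for x y c
    using B(1) that by (auto simp: max_adjacent_def)
  have not: "{u, v} \<notin> untied (reweigh u v B es)"
  proof
    assume "{u, v} \<in> untied (reweigh u v B es)"
    then obtain x y c where xy: "{u, v} = {x, y}" "(x, y, c) \<in> set (reweigh u v B es)"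
      "\<not> (\<exists>x' y'. (x', y', c) \<in> set (reweigh u v B es) \<and> adjacent {x', y'} {x, y})"
      unfolding untied_def by blast
    have c: "c = B" "0 < B" using xy(1,2) by (auto simp: set_reweigh)
    then obtain x' y' where f: "(x', y', B) \<in> set es" "adjacent {x', y'} {u, v}"
      using B(1) by (auto simp: max_adjacent_def)
    then have "(x', y', B) \<in> set (reweigh u v B es)" by (simp add: set_reweigh adjacent_def)
    with f xy c show False by auto
  qed
  show "untied (reweigh u v B es) \<subseteq> untied es"
  proof
    fix g assume g: "g \<in> untied (reweigh u v B es)"
    then obtain x y c where xy: "g = {x, y}" "(x, y, c) \<in> set (reweigh u v B es)"
      "\<not> (\<exists>x' y'. (x', y', c) \<in> set (reweigh u v B es) \<and> adjacent {x', y'} {x, y})"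
      unfolding untied_def by blast
    have ne: "{x, y} \<noteq> {u, v}" using g not xy by auto
    then have xyc: "(x, y, c) \<in> set es" using xy by (simp add: set_reweigh)
    have "\<not> (\<exists>x' y'. (x', y', c) \<in> set es \<and> adjacent {x', y'} {x, y})"
    proof
      assume "\<exists>x' y'. (x', y', c) \<in> set es \<and> adjacent {x', y'} {x, y}"
      then obtain x' y' where f: "(x', y', c) \<in> set es" "adjacent {x', y'} {x, y}" by blast
      show False
      proof (cases "{x', y'} = {u, v}")
        case True
        then have "c = M" using wf_edges_unique[OF wf e f(1)] by simp
        moreover have "c \<le> B" using low[OF xyc] f(2) True by (auto simp: adjacent_def)
        ultimately show False using B(2) by simp
      next
        case False
        then have "(x', y', c) \<in> set (reweigh u v B es)" using f by (simp add: set_reweigh)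
        with f xy show False by blast
      qed
    qed
    with xyc xy show "g \<in> untied es" unfolding untied_def by blast
  qed
  have "{u, v} \<in> untied es"
    unfolding untied_def using e low B(2) by fastforce
  with not show "untied (reweigh u v B es) \<noteq> untied es" by auto
qed

text \<open>Bounds one round of the loop on at most \<open>n\<close> edges with numbers of at most
  \<open>b\<close> bits. The last summand is the search for reducible edges; \<open>7 * n\<close>
  covers choosing one and rewriting the list, \<open>4 * b\<close> the two subtractions.\<close>

definition round_cost :: "real \<Rightarrow> real \<Rightarrow> real" where
  "round_cost n b = 7 + 4 * b + 7 * n + n * (3 + 2 * b + n * (5 + 2 * b))"

lemma runs_within_subtract:
  "ibits P \<le> b \<Longrightarrow> bits d \<le> c \<Longrightarrow> runs_within (subtract P d) (1 + real b + real c) (\<lambda>x. x = P - int d)"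
  unfolding subtract_def by (rule runs_within_charge) auto

text \<open>The last conjunct is irreducibility. Applied to a heaviest edge, it provides the two
  adjacent edges of maximum weight on which the algorithm branches.\<close>

definition reduced ::
    "nat \<Rightarrow> 'a set \<Rightarrow> 'a wedge_list \<Rightarrow> int \<Rightarrow> 'a wedge_list \<Rightarrow> int \<Rightarrow> bool" where
  "reduced b V es P es' P' \<longleftrightarrow>
     wf_edges V es' \<and> length es' \<le> length es \<and> bounded b es' P' \<and> P' \<le> P \<and>
     (solvable_list V es' P' \<longleftrightarrow> solvable_list V es P) \<and>
     (\<forall>x y c. (x, y, c) \<in> set es' \<longrightarrow>
        (\<exists>x' y' c'. (x', y', c') \<in> set es' \<and> adjacent {x', y'} {x, y} \<and> c \<le> c'))"

text \<open>Induction on the number of untied edges, which drops in every proper round; the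
  additional \<open>Suc\<close> pays for the final round, which finds nothing to reduce.\<close>

lemma runs_within_reduce:
  assumes pick: "valid_pick pick" and V: "finite V"
    and "wf_edges V es" and "bounded b es P" and "length es \<le> n"
  shows "runs_within (reduce pick es P) (real (Suc (card (untied es))) * round_cost n b)
    (\<lambda>(es', P'). reduced b V es P es' P')"
  using assms(3-5)
proof (induction "card (untied es)" arbitrary: es P rule: less_induct)
  case less
  note wf = less.prems(1) and bd = less.prems(2) and n = less.prems(3)
  let ?R = "round_cost n b"
  have w: "\<forall>(x, y, c)\<in>set es. bits c \<le> b" using bounded_bits_weight[OF bd] by auto
  have n2: "real (length es) * (3 + 2 * real b + real (length es) * (5 + 2 * real b))
      \<le> real n * (3 + 2 * real b + real n * (5 + 2 * real b))"
    using n by (intro mult_mono add_mono) auto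
  have R0: "0 \<le> ?R" by (simp add: round_cost_def)
  show ?case
    apply (subst reduce.simps)
    apply (rule runs_within_run_then[OF runs_within_reductions[OF w order_refl]])
    apply (rule runs_within_charge_then)
  proof -
    fix rs
    assume rs: "length rs \<le> length es \<and>
        (\<forall>(u, v, M, B)\<in>set rs. (u, v, M) \<in> set es \<and> max_adjacent u v es B \<and> B < M) \<and>
        (rs = [] \<longrightarrow> (\<forall>(u, v, M)\<in>set es. \<exists>B\<ge>M. max_adjacent u v es B))"
    let ?T = "real (Suc (card (untied es))) * ?R -
      (1 + real (length es) * (3 + 2 * real b + real (length es) * (5 + 2 * real b))) - real 1"
    \<comment> \<open>What is left after the search is the full allowance for the later rounds plus
      the remainder of the present one.\<close>
    have T: "real (card (untied es)) * ?R + 5 + 4 * real b + 7 * real n \<le> ?T"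
      using n2 by (simp add: algebra_simps round_cost_def)
    have T1: "1 \<le> ?T" using mult_nonneg_nonneg[OF _ R0, of "real (card (untied es))"] T by linarith
    show "runs_within (if rs = [] then charge 1 (es, P)
       else charge (1 + length rs) (pick rs) \<triangleright> (\<lambda>(u, v, M, B).
         set_weight u v B es \<triangleright> (\<lambda>es'. charge (1 + bits M + bits B) (M - B) \<triangleright> (\<lambda>d.
         subtract P d \<triangleright> (\<lambda>P'. reduce pick es' P'))))) ?T
      (\<lambda>(es', P'). reduced b V es P es' P')"
    proof (cases "rs = []")
      case True
      have "\<exists>x' y' c'. (x', y', c') \<in> set es \<and> adjacent {x', y'} {x, y} \<and> c \<le> c'"
        if e: "(x, y, c) \<in> set es" for x y c
      proof -
        obtain B where "B \<ge> c" "max_adjacent x y es B" using rs True e by fastforce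
        \<comment> \<open>Together with \<open>c \<le> B\<close> this excludes the default
          \<open>B = 0\<close>, so \<open>B\<close> is the weight of an actual neighbour.\<close>
        moreover have "0 < c" using wf e by (auto simp: wf_edges_def)
        ultimately show ?thesis by (auto simp: max_adjacent_def)
      qed
      then show ?thesis using True wf bd T1 by (auto intro!: runs_within_charge simp: reduced_def)
    next
      case False
      obtain u v M B where p: "pick rs = (u, v, M, B)" by (cases "pick rs")
      then have "(u, v, M, B) \<in> set rs" using pick False by (metis valid_pick_def)
      then have e: "(u, v, M) \<in> set es" and B: "max_adjacent u v es B" "B < M" using rs by auto
      let ?es = "reweigh u v B es" and ?P = "P - int (M - B)"
      have tot: "total ?es + M = total es + B"
        using wf e by (intro total_reweigh) (auto simp: wf_edges_def)
      have bd': "bounded b ?es ?P"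
        by (rule bounded_mono[OF bd]) (use tot B in auto)
      have bM: "bits M \<le> b" using w e by auto
      have bB: "bits B \<le> b" "bits (M - B) \<le> b"
        using bM floorlog_mono[of B M 2] floorlog_mono[of "M - B" M 2] B(2) by auto
      have dec: "card (untied ?es) < card (untied es)"
        using untied_reweigh[OF wf e B] finite_subset[OF untied_subset[of es]]
        by (intro psubset_card_mono) auto
      have len: "length ?es \<le> length es" by (rule length_reweigh_le)
      note IH = less.hyps[OF dec wf_edges_reweigh[OF wf] bd' order_trans[OF len n]]
      have sw: "runs_within (set_weight u v B es) (1 + 6 * real (length es)) (\<lambda>x. x = ?es)"
        by (simp add: runs_within_def set_weight_eq)
      have le: "real (Suc (card (untied ?es))) * ?R \<le> real (card (untied es)) * ?R"
        using dec R0 by (intro mult_right_mono) auto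
      show ?thesis
        apply (simp only: False if_False)
        apply (rule runs_within_charge_then)
        apply (simp only: p prod.case)
        apply (rule runs_within_run_then[OF sw])
        apply (rule runs_within_charge_then)
        apply (rule runs_within_run_then[OF runs_within_subtract[OF bounded_ibits[OF bd] bB(2)]])
        apply (simp only:)
        apply (rule runs_within_weaken[OF IH])
        subgoal using T le rs n bM bB by simp
        subgoal using solvable_reweigh[OF V wf e B, of P] len by (auto simp: reduced_def)
        done
    qed
  qed
qed

subsection \<open>The branching step\<close>

lemma runs_within_if:
  "(c \<Longrightarrow> runs_within f T Q) \<Longrightarrow> (\<not> c \<Longrightarrow> runs_within g T Q) \<Longrightarrow> runs_within (if c then f else g) T Q"
  by simp

lemma runs_within_run_then_pair:
  assumes "runs_within m S Q" and "\<And>x y. Q (x, y) \<Longrightarrow> runs_within (f x y) (T - S) R"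
  shows "runs_within (m \<triangleright> (\<lambda>(x, y). f x y)) T R"
  by (rule runs_within_run_then[OF assms(1)]) (auto intro: assms(2))

lemma runs_within_max_weight:
  assumes "\<forall>(x, y, c)\<in>set es. bits c \<le> b"
  shows "runs_within (max_weight es) (1 + real (length es) * (1 + 2 * real b))
    (\<lambda>W. bits W \<le> b \<and> (\<forall>x y c. (x, y, c) \<in> set es \<longrightarrow> c \<le> W) \<and>
       (if es = [] then W = 0 else \<exists>x y. (x, y, W) \<in> set es))"
  using assms
proof (induction es)
  case Nil
  show ?case by (auto intro!: runs_within_charge)
next
  case (Cons e es)
  obtain x y c where e: "e = (x, y, c)" by (cases e)
  have c: "bits c \<le> b" using Cons.prems by (simp add: e)
  have IH: "runs_within (max_weight es) (1 + real (length es) * (1 + 2 * real b))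
    (\<lambda>W. bits W \<le> b \<and> (\<forall>x y c. (x, y, c) \<in> set es \<longrightarrow> c \<le> W) \<and>
       (if es = [] then W = 0 else \<exists>x y. (x, y, W) \<in> set es))"
    using Cons by simp
  show ?case unfolding e max_weight.simps
    apply (rule runs_within_run_then[OF IH])
    apply (rule runs_within_charge)
    subgoal using c by (simp add: algebra_simps)
    subgoal using c by (cases "es = []") (fastforce simp: max_def split: if_splits)+
    done
qed

lemma forget_weights_eq:
  "forget_weights es = Some (map (\<lambda>(x, y, c). (x, y)) es, 1 + length es)"
  by (induction es) (auto simp: charge_def run_then_def)

lemma runs_within_heaviest:
  assumes "\<forall>(x, y, c)\<in>set es. bits c \<le> b" and W: "bits W \<le> b"
  shows "runs_within (heaviest W es) (1 + real (length es) * (2 + 2 * real b))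
    (\<lambda>hs. length hs \<le> length es \<and> (\<forall>x y. (x, y) \<in> set hs \<longleftrightarrow> (x, y, W) \<in> set es))"
    (is "runs_within _ (?T es) (?Q es)")
  using assms(1)
proof (induction es)
  case Nil
  show ?case by (auto intro!: runs_within_charge)
next
  case (Cons e es)
  obtain x y c where e: "e = (x, y, c)" by (cases e)
  have c: "bits c \<le> b" using Cons.prems by (simp add: e)
  have IH: "runs_within (heaviest W es) (?T es) (?Q es)"
    using Cons by simp
  show ?case unfolding e heaviest.simps
    apply (rule runs_within_run_then[OF IH])
    apply (rule runs_within_charge_then)
    apply (rule runs_within_charge)
    subgoal using c W by (simp add: algebra_simps)
    subgoal by auto
    done
qed

text \<open>An edge is listed with its end points in any order, hence the disjunctions over
  orientations. Completeness is only claimed as \<open>fs \<noteq> []\<close>, since any fork is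
  good enough for the branching.\<close>

lemma runs_within_forks_at:
  "runs_within (forks_at x y es) (1 + 5 * real (length es))
    (\<lambda>fs. length fs \<le> length es \<and>
       (\<forall>u v v'. (u, v, v') \<in> set fs \<longrightarrow> v \<noteq> v' \<and> ((u, v) = (x, y) \<or> (v, u) = (x, y)) \<and>
          ((u, v') \<in> set es \<or> (v', u) \<in> set es)) \<and>
       ((\<exists>x' y'. (x', y') \<in> set es \<and> adjacent {x', y'} {x, y}) \<longrightarrow> fs \<noteq> []))"
    (is "runs_within _ (?T es) (?Q es)")
proof (induction es)
  case Nil
  show ?case by (auto intro!: runs_within_charge)
next
  case (Cons e es)
  obtain a b where e: "e = (a, b)" by (cases e)
  show ?case unfolding e forks_at.simps
  proof (rule runs_within_run_then[OF Cons.IH], rule runs_within_charge)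
    fix fs assume fs: "?Q es fs"
    let ?fs = "if x = a \<and> y \<noteq> b then (x, y, b) # fs else if x = b \<and> y \<noteq> a then (x, y, a) # fs
      else if y = a \<and> x \<noteq> b then (y, x, b) # fs else if y = b \<and> x \<noteq> a then (y, x, a) # fs else fs"
    \<comment> \<open>The four equality tests between end points determine both the branch taken and
      whether the two edges are adjacent.\<close>
    have new: "?fs = fs \<and> \<not> adjacent {a, b} {x, y} \<or> (\<exists>u v v'. ?fs = (u, v, v') # fs \<and> v \<noteq> v' \<and>
        ((u, v) = (x, y) \<or> (v, u) = (x, y)) \<and> ((u, v') = (a, b) \<or> (v', u) = (a, b)))"
      by (cases "x = a"; cases "x = b"; cases "y = a"; cases "y = b")
        (simp_all add: adjacent_def insert_commute)
    show "?Q ((a, b) # es) ?fs"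
    proof -
      from new consider "?fs = fs" "\<not> adjacent {a, b} {x, y}"
        | u v v' where "?fs = (u, v, v') # fs" "v \<noteq> v'" "(u, v) = (x, y) \<or> (v, u) = (x, y)"
          "(u, v') = (a, b) \<or> (v', u) = (a, b)"
        by blast
      then show ?thesis
      proof cases
        case 1
        show ?thesis unfolding 1(1) using fs 1(2) by (simp, blast)
      next
        case 2
        show ?thesis unfolding 2(1) using fs 2(2-) by (simp, blast)
      qed
    qed
  qed simp
qed

text \<open>The quadratic bound on the length is carried along because choosing a fork is charged
  the length of the list.\<close>

lemma runs_within_forks:
  "runs_within (forks all es) (1 + real (length es) * (2 + 6 * real (length all)))
    (\<lambda>fs. length fs \<le> length es * length all \<and>
       (\<forall>u v v'. (u, v, v') \<in> set fs \<longrightarrow> v \<noteq> v' \<and> ((u, v) \<in> set es \<or> (v, u) \<in> set es) \<and>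
          ((u, v') \<in> set all \<or> (v', u) \<in> set all)) \<and>
       ((\<exists>x y x' y'. (x, y) \<in> set es \<and> (x', y') \<in> set all \<and> adjacent {x', y'} {x, y}) \<longrightarrow> fs \<noteq> []))"
    (is "runs_within _ (?T es) (?Q es)")
proof (induction es)
  case Nil
  show ?case by (auto intro!: runs_within_charge)
next
  case (Cons e es)
  obtain a b where e: "e = (a, b)" by (cases e)
  show ?case unfolding e forks.simps
    apply (rule runs_within_run_then[OF Cons.IH])
    apply (rule runs_within_run_then[OF runs_within_forks_at])
    apply (rule runs_within_charge)
    subgoal by (simp add: algebra_simps)
    subgoal for fs fs'
      apply (intro conjI)
      subgoal by simp
      subgoal by (simp, blast)
      subgoal by (simp, blast)
      done
    done
qed

section \<open>Deleting vertices, and correctness of the branching\<close>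

definition remove_incident :: "'a \<Rightarrow> 'a wedge_list \<Rightarrow> 'a wedge_list" where
  "remove_incident u es = filter (\<lambda>(x, y, c). x \<noteq> u \<and> y \<noteq> u) es"

lemma set_remove_incident:
  "(x, y, c) \<in> set (remove_incident u es) \<longleftrightarrow> (x, y, c) \<in> set es \<and> x \<noteq> u \<and> y \<noteq> u"
  by (auto simp: remove_incident_def)

lemma delete_from_vertices_eq:
  "delete_from_vertices u vs = Some (filter (\<lambda>x. x \<noteq> u) vs, 1 + 2 * length vs)"
  by (induction vs) (auto simp: charge_def run_then_def)

lemma delete_from_edges_eq:
  "delete_from_edges u es = Some (remove_incident u es, 1 + 3 * length es)"
  unfolding remove_incident_def by (induction es) (auto simp: charge_def run_then_def)

lemma runs_within_delete_vertex:
  assumes "length vs \<le> n" "length es \<le> n"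
  shows "runs_within (delete_vertex u (vs, es)) (3 + 5 * real n)
    (\<lambda>G. G = (filter (\<lambda>x. x \<noteq> u) vs, remove_incident u es))"
  using assms by (auto simp: delete_vertex_def delete_from_vertices_eq delete_from_edges_eq
      charge_def run_then_def runs_within_def)

lemma wf_edges_remove_incident:
  "wf_edges V es \<Longrightarrow> wf_edges (V - {u}) (remove_incident u es)"
  by (fastforce simp: wf_edges_def remove_incident_def distinct_map_filter)

lemma length_remove_incident_less:
  "(x, y, c) \<in> set es \<Longrightarrow> u \<in> {x, y} \<Longrightarrow> length (remove_incident u es) < length es"
  unfolding remove_incident_def by (rule length_filter_less) auto

lemma length_remove_incident_le: "length (remove_incident u es) \<le> length es"
  by (simp add: remove_incident_def)

lemma total_remove_incident_le: "total (remove_incident u es) \<le> total es"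
  by (induction es) (auto simp: total_def remove_incident_def)

text \<open>Counting one deleted edge of weight \<open>W\<close> per deleted vertex already makes up
  for the budget spent on that vertex, which preserves \<open>bounded\<close> in both
  branches.\<close>

lemma total_remove_incident:
  "(x, y, c) \<in> set es \<Longrightarrow> u \<in> {x, y} \<Longrightarrow> total (remove_incident u es) + c \<le> total es"
proof (induction es)
  case (Cons e es)
  show ?case
  proof (cases "e = (x, y, c)")
    case True
    then show ?thesis using Cons.prems total_remove_incident_le[of u es]
      by (auto simp: total_def remove_incident_def)
  next
    case False
    then show ?thesis using Cons by (auto simp: total_def remove_incident_def)
  qed
qed simp

text \<open>Power \<open>W\<close> at \<open>u\<close> covers all incident edges, as none is
  heavier, and the other powers are kept. This serves once for the first branch and twice for the
  second.\<close>

lemma solvable_insert_vertex: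
  assumes V: "finite V" "u \<in> V" and W: "\<And>x y c. (x, y, c) \<in> set es \<Longrightarrow> c \<le> W"
    and "solvable_list (V - {u}) (remove_incident u es) (P - int W)"
  shows "solvable_list V es P"
proof -
  obtain p :: "'a \<Rightarrow> real" where p: "\<forall>v\<in>V - {u}. 0 \<le> p v"
      "\<And>x y c. (x, y, c) \<in> set (remove_incident u es) \<Longrightarrow> real c \<le> p x \<or> real c \<le> p y"
      "sum p (V - {u}) \<le> real_of_int (P - int W)"
    using assms(4) unfolding solvable_list_def by blast
  define p' where "p' = p(u := real W)"
  have "sum p' V = p' u + sum p' (V - {u})" using V by (auto intro: sum.remove)
  also have "sum p' (V - {u}) = sum p (V - {u})" by (rule sum.cong) (auto simp: p'_def)
  finally have "sum p' V \<le> real_of_int P" using p(3) by (simp add: p'_def)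
  moreover have "real c \<le> p' x \<or> real c \<le> p' y" if "(x, y, c) \<in> set es" for x y c
    using p(2)[of x y c] W[OF that] that by (auto simp: set_remove_incident p'_def)
  moreover have "\<forall>v\<in>V. 0 \<le> p' v" using p(1) by (auto simp: p'_def)
  ultimately show ?thesis unfolding solvable_list_def by (intro exI[of _ p']) auto
qed

text \<open>If \<open>u\<close> has power below \<open>W\<close>, then \<open>v\<close> and
  \<open>v'\<close> must pay for the two edges. Restricting the solution to the remaining vertices
  keeps it feasible and frees at least \<open>W\<close> or, as \<open>v\<close> and
  \<open>v'\<close> are distinct, \<open>2 * W\<close>.\<close>

lemma solvable_branch:
  assumes V: "finite V" and wf: "wf_edges V es"
    and W: "\<And>x y c. (x, y, c) \<in> set es \<Longrightarrow> c \<le> W"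
    and e: "(u, v, W) \<in> set es \<or> (v, u, W) \<in> set es"
    and f: "(u, v', W) \<in> set es \<or> (v', u, W) \<in> set es" and "v \<noteq> v'"
  shows "solvable_list V es P \<longleftrightarrow>
    solvable_list (V - {u}) (remove_incident u es) (P - int W) \<or>
    solvable_list (V - {v} - {v'}) (remove_incident v' (remove_incident v es)) (P - int (2 * W))"
    (is "?S \<longleftrightarrow> ?S1 \<or> ?S2")
proof
  have uv: "u \<in> V" "v \<in> V" "v' \<in> V" using wf e f by (auto simp: wf_edges_def)
  show ?S if "?S1 \<or> ?S2"
    using that
  proof
    assume ?S1
    then show ?S using solvable_insert_vertex[of V u es W P] V uv W by blast
  next
    assume ?S2
    then have "solvable_list (V - {v} - {v'}) (remove_incident v' (remove_incident v es))
        (P - int W - int W)"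
      by (simp add: algebra_simps)
    then have "solvable_list (V - {v}) (remove_incident v es) (P - int W)"
      by (rule solvable_insert_vertex[rotated -1])
        (use V uv W \<open>v \<noteq> v'\<close> in \<open>auto simp: set_remove_incident\<close>)
    then show ?S by (rule solvable_insert_vertex[rotated -1]) (use V uv W in auto)
  qed
  assume ?S
  then obtain p :: "'a \<Rightarrow> real" where p: "\<forall>v\<in>V. 0 \<le> p v"
      "\<And>x y c. (x, y, c) \<in> set es \<Longrightarrow> real c \<le> p x \<or> real c \<le> p y"
      "sum p V \<le> real_of_int P"
    unfolding solvable_list_def by blast
  show "?S1 \<or> ?S2"
  proof (cases "real W \<le> p u")
    case True
    have "sum p V = p u + sum p (V - {u})" using V uv by (auto intro: sum.remove)
    moreover have "\<forall>(x, y, c)\<in>set (remove_incident u es). real c \<le> p x \<or> real c \<le> p y"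
      using p(2) by (fastforce simp: set_remove_incident)
    ultimately have ?S1 unfolding solvable_list_def using True p(1,3)
      by (intro exI[of _ p]) auto
    then show ?thesis ..
  next
    case False
    then have "real W \<le> p v" "real W \<le> p v'" using e f p(2) by blast+
    moreover have "sum p V = p v + sum p (V - {v})" using V uv by (auto intro: sum.remove)
    moreover have "sum p (V - {v}) = p v' + sum p (V - {v} - {v'})"
      using V uv \<open>v \<noteq> v'\<close> by (intro sum.remove) auto
    moreover have "\<forall>(x, y, c)\<in>set (remove_incident v' (remove_incident v es)).
        real c \<le> p x \<or> real c \<le> p y"
      using p(2) by (fastforce simp: set_remove_incident)
    ultimately have ?S2 unfolding solvable_list_def using p(1,3)
      by (intro exI[of _ p]) auto
    then show ?thesis ..
  qed
qed

section \<open>Unit weights and vertex cover\<close>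

lemma wf_edges_simple_graph: "finite V \<Longrightarrow> wf_edges V es \<Longrightarrow> simple_graph V (ends ` set es)"
  unfolding simple_graph_def wf_edges_def by fastforce

lemma wf_edges_encodes_graph:
  assumes "distinct vs" and "wf_edges (set vs) es"
  shows "encodes_graph (vs, map (\<lambda>(x, y, c). (x, y)) es) (set vs) (ends ` set es)"
proof -
  have "map (\<lambda>(x, y). {x, y}) (map (\<lambda>(x, y, c). (x, y)) es) = map ends es"
    by auto
  then have "distinct (map (\<lambda>(x, y). {x, y}) (map (\<lambda>(x, y, c). (x, y)) es))"
    using assms by (simp add: wf_edges_def del: map_map)
  then show ?thesis
    using assms(1) unfolding encodes_graph_def by (force simp: image_image)
qed

text \<open>Real powers are rounded: the vertices of power at least \<open>1\<close> form a cover
  whose size is at most the total power, and conversely the indicator function of a cover is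
  feasible. The condition \<open>0 \<le> P\<close> lets \<open>nat P\<close> stand for the
  budget.\<close>

lemma solvable_vertex_cover:
  assumes V: "finite V" and wf: "wf_edges V es"
    and one: "\<And>x y c. (x, y, c) \<in> set es \<Longrightarrow> c \<le> 1" and P: "0 \<le> P"
  shows "solvable_list V es P \<longleftrightarrow> (\<exists>C. vertex_cover V (ends ` set es) C \<and> card C \<le> nat P)"
proof
  have c1: "c = 1" if "(x, y, c) \<in> set es" for x y c
    using one[OF that] that wf by (auto simp: wf_edges_def)
  {
    assume "solvable_list V es P"
    then obtain p :: "'a \<Rightarrow> real" where p: "\<forall>v\<in>V. 0 \<le> p v"
      "\<And>x y c. (x, y, c) \<in> set es \<Longrightarrow> real c \<le> p x \<or> real c \<le> p y"
      "sum p V \<le> real_of_int P"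
      unfolding solvable_list_def by blast
    define C where "C = {v \<in> V. 1 \<le> p v}"
    have "real (card C) = (\<Sum>v\<in>C. 1)" by simp
    also have "\<dots> \<le> sum p C" by (rule sum_mono) (simp add: C_def)
    also have "\<dots> \<le> sum p V" using V p(1) by (intro sum_mono2) (auto simp: C_def)
    finally have "card C \<le> nat P" using p(3) P by linarith
    moreover have "vertex_cover V (ends ` set es) C"
      using p(2) c1 wf by (fastforce simp: vertex_cover_def C_def wf_edges_def)
    ultimately show "\<exists>C. vertex_cover V (ends ` set es) C \<and> card C \<le> nat P" by blast
  }
  {
    assume "\<exists>C. vertex_cover V (ends ` set es) C \<and> card C \<le> nat P"
    then obtain C where C: "vertex_cover V (ends ` set es) C" "card C \<le> nat P" by blast
    define p :: "'a \<Rightarrow> real" where "p v = (if v \<in> C then 1 else 0)" for v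
    have "C \<subseteq> V" using C by (simp add: vertex_cover_def)
    then have "sum p V = real (card C)"
      using V by (simp add: p_def sum.If_cases Int_absorb1)
    then have "sum p V \<le> real_of_int P" using C(2) P by linarith
    moreover have "real c \<le> p x \<or> real c \<le> p y" if "(x, y, c) \<in> set es" for x y c
    proof -
      have "{x, y} \<in> ends ` set es" using that by force
      then have "{x, y} \<inter> C \<noteq> {}" using C(1) unfolding vertex_cover_def by blast
      then show ?thesis using c1[OF that] by (auto simp: p_def)
    qed
    ultimately show "solvable_list V es P"
      unfolding solvable_list_def by (intro exI[of _ p]) (auto simp: p_def)
  }
qed

subsection \<open>The recursion\<close>

text \<open>Bounds the work of one call apart from its recursive calls and the vertex cover
  subroutine: at most \<open>n + 1\<close> rounds of reduction, then the passes over the lists. Of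
  \<open>7 * n * n\<close>, six parts are the search for forks and one is the choice among
  them.\<close>

definition node_cost :: "real \<Rightarrow> real \<Rightarrow> real" where
  "node_cost n b = (n + 1) * round_cost n b + 25 + 20 * n + 8 * b + 4 * n * b + 7 * n * n"

definition growth :: "int \<Rightarrow> real" where
  "growth P = 1.274 ^ nat (P + 4)"

lemma growth_mono: "P \<le> P' \<Longrightarrow> growth P \<le> growth P'"
  unfolding growth_def by (rule power_increasing) auto

lemma growth_ge_1: "1 \<le> growth P"
  by (simp add: growth_def)

lemma power_le_growth: "1.274 ^ nat P \<le> growth P"
  unfolding growth_def by (rule power_increasing) auto

text \<open>The branching numbers are \<open>(2, 4)\<close>, and \<open>1.274\<close> exceeds the root of \<open>x ^ 4 = x\<^sup>2 + 1\<close>; the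
  slack pays for the work at the node. The shift by \<open>4\<close> in the exponent covers the calls in which
  the budget has dropped below zero.\<close>

lemma growth_branch:
  assumes "0 \<le> P" and "2 \<le> W" and "0 \<le> Q"
  shows "Q + 100 * Q * growth (P - int W) + 100 * Q * growth (P - int (2 * W)) \<le> 100 * Q * growth P"
proof -
  obtain k where k: "P = int k" using assms(1) nonneg_int_cases by blast
  define z :: real where "z = 1.274 ^ k"
  have z: "1 \<le> z" by (simp add: z_def)
  have 1: "growth (P - int W) \<le> z * 1.274 ^ 2"
  proof -
    have "growth (P - int W) \<le> growth (P - 2)" using assms by (intro growth_mono) auto
    also have "nat (P - 2 + 4) = k + 2" by (simp add: k)
    then have "growth (P - 2) = z * 1.274 ^ 2" by (simp only: growth_def z_def power_add)
    finally show ?thesis .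
  qed
  have 2: "growth (P - int (2 * W)) \<le> z"
  proof -
    have "growth (P - int (2 * W)) \<le> growth (P - 4)" using assms by (intro growth_mono) auto
    also have "\<dots> = z" by (simp add: growth_def z_def k)
    finally show ?thesis .
  qed
  have "nat (P + 4) = k + 4" by (simp add: k)
  then have 3: "growth P = z * 1.274 ^ 4" by (simp only: growth_def z_def power_add)
  \<comment> \<open>The factor \<open>100\<close> originates here:
    \<open>1.274 ^ 4 - 1.274 ^ 2 - 1\<close> is about \<open>0.0113\<close>, so its product with
    \<open>100 * z\<close> exceeds \<open>1\<close> for \<open>z \<ge> 1\<close>.\<close>
  have "1 + 100 * growth (P - int W) + 100 * growth (P - int (2 * W)) \<le> 100 * growth P"
    using 1 2 z unfolding 3 by (simp add: power_numeral_even power_numeral_odd)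
  then have "Q * (1 + 100 * growth (P - int W) + 100 * growth (P - int (2 * W))) \<le> Q * (100 * growth P)"
    using assms(3) by (rule mult_left_mono)
  then show ?thesis by (simp add: algebra_simps)
qed

text \<open>The polynomial factor of the subroutine enters as a constant \<open>A\<close>, because
  it is called only on graphs and numbers within the fixed bounds \<open>n\<close> and
  \<open>b\<close>.\<close>

lemma runs_within_call_vc:
  assumes vc: "decides_vc vc"
    and time: "\<And>V E G k. simple_graph V E \<Longrightarrow> encodes_graph G V E \<Longrightarrow> length (fst G) \<le> n \<Longrightarrow>
      length (snd G) \<le> n \<Longrightarrow> bits k \<le> b \<Longrightarrow> real (snd (vc G k)) \<le> A * 1.274 ^ k"
    and wf: "wf_edges (set vs) es" "distinct vs" "length vs \<le> n" "length es \<le> n"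
    and one: "\<And>x y c. (x, y, c) \<in> set es \<Longrightarrow> c \<le> 1" and P: "0 \<le> P" "ibits P \<le> b"
  shows "runs_within (call_vc vc (vs, es) P) (2 + real n + real b + A * 1.274 ^ nat P)
    (\<lambda>ans. ans \<longleftrightarrow> solvable_list (set vs) es P)"
proof -
  let ?G = "(vs, map (\<lambda>(x, y, c). (x, y)) es)"
  note G = wf_edges_simple_graph[OF _ wf(1)] wf_edges_encodes_graph[OF wf(2,1)]
  have "real (snd (vc ?G (nat P))) \<le> A * 1.274 ^ nat P"
    by (rule time[OF G]) (use wf P in auto)
  moreover have "fst (vc ?G (nat P)) \<longleftrightarrow>
      (\<exists>C. vertex_cover (set vs) (ends ` set es) C \<and> card C \<le> nat P)"
    using vc G(1)[OF finite_set] G(2) unfolding decides_vc_def by simp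
  moreover have "solvable_list (set vs) es P \<longleftrightarrow>
      (\<exists>C. vertex_cover (set vs) (ends ` set es) C \<and> card C \<le> nat P)"
    by (rule solvable_vertex_cover[OF finite_set wf(1) one P(1)])
  ultimately show ?thesis
    using wf(4) P by (cases "vc ?G (nat P)")
      (simp add: call_vc_def forget_weights_eq run_then_def charge_def runs_within_def)
qed

text \<open>Induction on the number of edges, which both branches decrease. The bounds
  \<open>n\<close>, \<open>b\<close> and \<open>A\<close> stay fixed throughout the recursion tree,
  so every node has the same cost and \<open>growth\<close> alone measures the size of the
  tree.\<close>

lemma runs_within_pvc_branching:
  assumes vc: "decides_vc vc"
    and time: "\<And>V E G k. simple_graph V E \<Longrightarrow> encodes_graph G V E \<Longrightarrow> length (fst G) \<le> n \<Longrightarrow>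
      length (snd G) \<le> n \<Longrightarrow> bits k \<le> b \<Longrightarrow> real (snd (vc G k)) \<le> A * 1.274 ^ k"
    and A: "0 \<le> A"
    and pick: "valid_pick pick_reduction" "valid_pick pick_fork"
    and "wf_edges (set vs) es" and "distinct vs" and "bounded b es P"
    and "length vs \<le> n" and "length es \<le> n"
  shows "runs_within (pvc_branching vc pick_reduction pick_fork (vs, es) P)
    (100 * (node_cost n b + A) * growth P) (\<lambda>ans. ans \<longleftrightarrow> solvable_list (set vs) es P)"
  using assms(6-)
proof (induction "length es" arbitrary: vs es P rule: less_induct)
  case less
  note wf = less.prems(1,2) and bd = less.prems(3) and vn = less.prems(4) and en = less.prems(5)
  let ?Q = "node_cost n b + A"
  have round0: "0 \<le> round_cost n b" by (simp add: round_cost_def)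
  have node0: "0 \<le> node_cost n b" using round0 by (simp add: node_cost_def)
  have node_eq: "node_cost n b = (real n + 1) * round_cost n b + 25 + 20 * real n + 8 * real b
      + 4 * (real n * real b) + 7 * (real n * real n)"
    by (simp add: node_cost_def)
  have nonneg: "0 \<le> real n * real b" "0 \<le> real n * real n" by simp_all
  have node_ge: "(real n + 1) * round_cost n b + real 2 + real 1 \<le> node_cost n b"
    by (simp add: node_cost_def)
  have Q0: "0 \<le> ?Q" using A node0 by simp
  \<comment> \<open>For the leaves with negative budget or without edges: there the allowance only
    has to cover the node itself.\<close>
  have Q100: "?Q \<le> 100 * ?Q * growth P'" for P'
  proof -
    have "?Q * 1 \<le> ?Q * (100 * growth P')"
      using growth_ge_1[of P'] Q0 by (intro mult_left_mono) auto
    then show ?thesis by (simp add: mult_ac)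
  qed
  have reduce: "runs_within (reduce pick_reduction es P) ((real n + 1) * round_cost n b)
      (\<lambda>(es', P'). reduced b (set vs) es P es' P')"
    by (rule runs_within_mono[OF runs_within_reduce[OF pick(1) _ wf(1) bd en]], simp,
        rule mult_right_mono)
      (use card_untied_le[of es] en round0 in auto)
  show ?case
    apply (subst pvc_branching.simps)
    apply (simp only: fst_conv snd_conv)
    apply (rule runs_within_run_then_pair[OF reduce])
    apply (rule runs_within_charge_then)
    subgoal premises prems for es' P'
    proof -
      have red: "reduced b (set vs) es P es' P'" using prems by simp
      then have wf': "wf_edges (set vs) es'" and len': "length es' \<le> length es"
        and bd': "bounded b es' P'" and "P' \<le> P"
        and solv': "solvable_list (set vs) es' P' \<longleftrightarrow> solvable_list (set vs) es P"
        and irr: "\<And>x y c. (x, y, c) \<in> set es' \<Longrightarrow>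
          \<exists>x' y' c'. (x', y', c') \<in> set es' \<and> adjacent {x', y'} {x, y} \<and> c \<le> c'"
        unfolding reduced_def by blast+
      have en': "length es' \<le> n" using len' en by simp
      have w: "\<forall>(x, y, c)\<in>set es'. bits c \<le> b" using bounded_bits_weight[OF bd'] by auto
      \<comment> \<open>Reductions never raise the budget, so it suffices to stay within the
        allowance for \<open>P'\<close>.\<close>
      have P: "100 * ?Q * growth P' \<le> 100 * ?Q * growth P"
        using growth_mono[OF \<open>P' \<le> P\<close>] Q0 by (intro mult_left_mono) auto
      note max_weight = runs_within_mono[OF runs_within_max_weight[OF w],
          of "1 + real n * (1 + 2 * real b)"]
      note heaviest = runs_within_mono[OF runs_within_heaviest[OF w],
          of _ "1 + real n * (2 + 2 * real b)"]
      show ?thesis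
        apply (rule runs_within_if)
        subgoal
        proof (rule runs_within_charge)
          assume "P' < 0"
          then have "\<not> solvable_list (set vs) es' P'"
            unfolding solvable_list_def using sum_nonneg[of "set vs"] by force
          then show "False \<longleftrightarrow> solvable_list (set vs) es P" using solv' by auto
          show "real 1 \<le> 100 * ?Q * growth P - (real n + 1) * round_cost n b - real 1"
            using Q100[of P] A node_ge by linarith
        qed
        apply (rule runs_within_charge_then)
        apply (rule runs_within_if)
        subgoal
        proof (rule runs_within_charge)
          assume "es' = []" "\<not> P' < 0"
          then have "solvable_list (set vs) es' P'"
            unfolding solvable_list_def by (intro exI[of _ "\<lambda>_. 0"]) auto
          then show "True \<longleftrightarrow> solvable_list (set vs) es P" using solv' by auto
          show "real 1 \<le> 100 * ?Q * growth P - (real n + 1) * round_cost n b - real 1 - real 1"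
            using Q100[of P] A node_ge by linarith
        qed
        apply (rule runs_within_run_then[OF max_weight])
        subgoal using en' by (simp add: mult_right_mono)
        apply (rule runs_within_charge_then)
        apply (rule runs_within_if)
        subgoal premises W for W
        proof -
          have bW: "real (bits W) \<le> real b" using W by simp
          show ?thesis
          proof (rule runs_within_weaken[OF runs_within_call_vc[OF vc time wf' less.prems(2) vn en']])
            fix x y c assume "(x, y, c) \<in> set es'"
            then show "c \<le> 1" using W by auto
          next
            show "0 \<le> P'" using W by simp
            show "ibits P' \<le> b" by (rule bounded_ibits[OF bd'])
            show "(ans \<longleftrightarrow> solvable_list (set vs) es P)" if "ans \<longleftrightarrow> solvable_list (set vs) es' P'" for ans
              using that solv' by simp
            have "A * 1.274 ^ nat P' \<le> A * growth P'"
              using power_le_growth[of P'] A by (rule mult_left_mono)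
            moreover have "node_cost n b \<le> node_cost n b * growth P'"
              using mult_left_mono[OF growth_ge_1[of P'], of "node_cost n b"] node0 by simp
            moreover have "0 \<le> ?Q * growth P'"
              using Q0 growth_ge_1[of P'] by (intro mult_nonneg_nonneg) linarith+
            ultimately have "node_cost n b + A * 1.274 ^ nat P' \<le> 100 * ?Q * growth P'"
              by (simp add: algebra_simps)
            then show "2 + real n + real b + A * 1.274 ^ nat P' \<le>
              100 * ?Q * growth P - (real n + 1) * round_cost n b - real 1 - real 1
                - (1 + real n * (1 + 2 * real b)) - real (2 + bits W)"
              using P bW node_eq nonneg by (simp only: distrib_left mult_1_right)
          qed (use time in auto)
        qed
        subgoal premises prems for W
        proof -
          have P0: "0 \<le> P'" and ne: "es' \<noteq> []" and bW: "bits W \<le> b"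
            and maxW: "\<And>x y c. (x, y, c) \<in> set es' \<Longrightarrow> c \<le> W"
            and exW: "\<exists>x y. (x, y, W) \<in> set es'" and W1: "W \<noteq> 1"
            using prems by auto
          from exW obtain x y where xy: "(x, y, W) \<in> set es'" by blast
          then have "0 < W" using wf' by (auto simp: wf_edges_def)
          then have W2: "2 \<le> W" using W1 by simp
          \<comment> \<open>Irreducibility at a heaviest edge yields a neighbour that is at least as
            heavy, hence also of weight \<open>W\<close>. Therefore forks exist, and
            \<open>pick_fork\<close> is applied to a nonempty list.\<close>
          obtain x' y' c' where xy': "(x', y', c') \<in> set es'" "adjacent {x', y'} {x, y}" "W \<le> c'"
            using irr[OF xy] by blast
          then have "c' = W" using maxW[OF xy'(1)] by simp
          note xy' = xy'[unfolded this]
          note branch = growth_branch[OF P0 W2 Q0]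
          show ?thesis
            apply (rule runs_within_run_then[OF heaviest[OF bW]])
            subgoal using en' by (simp add: mult_right_mono)
            subgoal premises hs for hs
            proof -
              have hn: "length hs \<le> n" using hs en' by simp
              have hs: "(a, b) \<in> set hs \<longleftrightarrow> (a, b, W) \<in> set es'" for a b using hs by blast
              have forks: "runs_within (forks hs hs) (1 + real n * (2 + 6 * real n))
                (\<lambda>fs. fs \<noteq> [] \<and> real (length fs) \<le> real n * real n \<and>
                   (\<forall>u v v'. (u, v, v') \<in> set fs \<longrightarrow> v \<noteq> v' \<and>
                      ((u, v, W) \<in> set es' \<or> (v, u, W) \<in> set es') \<and>
                      ((u, v', W) \<in> set es' \<or> (v', u, W) \<in> set es')))"
              proof (rule runs_within_weaken[OF runs_within_forks], goal_cases)
                case 1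
                show ?case using hn by (intro add_mono mult_mono) auto
              next
                case (2 fs)
                then have "length fs \<le> n * n" using hn mult_le_mono[OF hn hn] by simp
                then have "real (length fs) \<le> real n * real n"
                  by (metis of_nat_le_iff of_nat_mult)
                moreover have "fs \<noteq> []" using 2 xy xy' hs by blast
                ultimately show ?case using 2 by (simp add: hs)
              qed
              show ?thesis
                apply (rule runs_within_run_then[OF forks])
                apply (rule runs_within_charge_then)
                subgoal premises fs for fs
                proof -
                  obtain u v v' where uvv: "pick_fork fs = (u, v, v')" by (cases "pick_fork fs")
                  then have "(u, v, v') \<in> set fs" using fs pick(2) by (metis valid_pick_def)
                  then have "v \<noteq> v'" and e: "(u, v, W) \<in> set es' \<or> (v, u, W) \<in> set es'"
                    and f: "(u, v', W) \<in> set es' \<or> (v', u, W) \<in> set es'" using fs by blast+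
                  have "u \<noteq> v" "u \<noteq> v'" using wf' e f by (auto simp: wf_edges_def)
                  let ?vs1 = "filter (\<lambda>x. x \<noteq> u) vs" and ?es1 = "remove_incident u es'"
                  let ?vs2 = "filter (\<lambda>x. x \<noteq> v) vs" and ?es2 = "remove_incident v es'"
                  let ?vs3 = "filter (\<lambda>x. x \<noteq> v') ?vs2" and ?es3 = "remove_incident v' ?es2"
                  have s1: "set ?vs1 = set vs - {u}" and s3: "set ?vs3 = set vs - {v} - {v'}"
                    by auto
                  have l1: "length ?vs1 \<le> n" and l2: "length ?vs2 \<le> n" and l3: "length ?vs3 \<le> n"
                    using vn by (auto intro: order_trans[OF length_filter_le])
                  have t1: "total ?es1 + W \<le> total es'" and e1: "length ?es1 < length es'"
                    using e by (auto intro: total_remove_incident length_remove_incident_less)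
                  have t2: "total ?es2 + W \<le> total es'" and e2: "length ?es2 < length es'"
                    using e by (auto intro: total_remove_incident length_remove_incident_less)
                  \<comment> \<open>The second edge of the fork does not contain \<open>v\<close>,
                    so it survives the first deletion, and deleting \<open>v'\<close> removes a
                    further weight of at least \<open>W\<close>.\<close>
                  have "(u, v', W) \<in> set ?es2 \<or> (v', u, W) \<in> set ?es2"
                    using f \<open>u \<noteq> v\<close> \<open>v \<noteq> v'\<close> by (auto simp: set_remove_incident)
                  then have t3: "total ?es3 + W \<le> total ?es2"
                    by (auto intro: total_remove_incident)
                  have e3: "length ?es3 \<le> length ?es2" by (rule length_remove_incident_le)
                  have b1: "bounded b ?es1 (P' - int W)"
                    by (rule bounded_mono[OF bd']) (use t1 in auto)
                  have b3: "bounded b ?es3 (P' - int (2 * W))"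
                    by (rule bounded_mono[OF bd']) (use t2 t3 in auto)
                  \<comment> \<open>The two deletions show that \<open>2 * W\<close> is at most the
                    total weight, which has at most \<open>b\<close> bits.\<close>
                  have b2W: "bits (2 * W) \<le> b"
                    using t2 t3 bd' by (intro bits_le) (auto simp: bounded_def)
                  have w1: "wf_edges (set ?vs1) ?es1"
                    unfolding s1 by (rule wf_edges_remove_incident[OF wf'])
                  have w3: "wf_edges (set ?vs3) ?es3"
                    unfolding s3 by (intro wf_edges_remove_incident wf')
                  have IH1: "runs_within
                      (pvc_branching vc pick_reduction pick_fork (?vs1, ?es1) (P' - int W))
                      (100 * ?Q * growth (P' - int W))
                      (\<lambda>ans. ans \<longleftrightarrow> solvable_list (set ?vs1) ?es1 (P' - int W))"
                    by (rule less.hyps) (use w1 b1 l1 e1 len' en less.prems(2) in auto)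
                  have IH2: "runs_within
                      (pvc_branching vc pick_reduction pick_fork (?vs3, ?es3) (P' - int (2 * W)))
                      (100 * ?Q * growth (P' - int (2 * W)))
                      (\<lambda>ans. ans \<longleftrightarrow> solvable_list (set ?vs3) ?es3 (P' - int (2 * W)))"
                    by (rule less.hyps) (use w3 b3 l3 e2 e3 len' en less.prems(2) in auto)
                  note P'b = bounded_ibits[OF bd']
                  show ?thesis
                    apply (simp only: uvv prod.case)
                    apply (rule runs_within_run_then[OF runs_within_delete_vertex[OF vn en']])
                    apply (rule runs_within_run_then[OF runs_within_subtract[OF P'b bW]])
                    apply (simp only:)
                    apply (rule runs_within_run_then[OF IH1])
                    apply (rule runs_within_run_then[OF runs_within_delete_vertex[OF vn en']])
                    apply (simp only:)
                    apply (rule runs_within_run_then[OF runs_within_delete_vertex[OF l2 order_trans[OF less_imp_le[OF e2] en']]])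
                    apply (rule runs_within_charge_then)
                    apply (rule runs_within_run_then[OF runs_within_subtract[OF P'b b2W]])
                    apply (simp only:)
                    apply (rule runs_within_run_then[OF IH2])
                    apply (rule runs_within_charge)
                    subgoal using branch P fs bW A unfolding node_cost_def by (simp add: algebra_simps)
                    subgoal using solvable_branch[OF finite_set wf' maxW e f \<open>v \<noteq> v'\<close>, where P = P'] solv'
                      unfolding s1 s3 by simp
                    done
                qed
                done
            qed
            done
        qed
        done
    qed
    done
qed

section \<open>From encoded instances to polynomial bounds in the input size\<close>

text \<open>A polynomial in a running time bound need be neither monotone nor nonnegative; replacing
  its coefficients by their absolute values makes it both on nonnegative arguments.\<close>

lemma poly_bound_monotone:
  fixes q :: "real poly"
  obtains r where "\<And>x y. 0 \<le> x \<Longrightarrow> x \<le> y \<Longrightarrow> poly q x \<le> poly r y" "\<And>y. 0 \<le> y \<Longrightarrow> 0 \<le> poly r y"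
proof -
  have "\<exists>r. \<forall>x y. 0 \<le> x \<longrightarrow> x \<le> y \<longrightarrow> poly q x \<le> poly r y \<and> 0 \<le> poly r y"
  proof (induction q)
    case 0
    show ?case by (intro exI[of _ 0]) simp
  next
    case (pCons a q)
    then obtain r where r: "\<And>x y. 0 \<le> x \<Longrightarrow> x \<le> y \<Longrightarrow> poly q x \<le> poly r y \<and> 0 \<le> poly r y"
      by blast
    have "a + x * poly q x \<le> \<bar>a\<bar> + y * poly r y \<and> 0 \<le> \<bar>a\<bar> + y * poly r y"
      if "0 \<le> x" "x \<le> y" for x y
    proof -
      have "x * poly q x \<le> x * poly r y" using r[OF that] that by (intro mult_left_mono) auto
      also have "\<dots> \<le> y * poly r y" using r[OF that] that by (intro mult_right_mono) auto
      finally show ?thesis using r[OF that] that by auto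
    qed
    then show ?case by (intro exI[of _ "pCons \<bar>a\<bar> r"]) simp
  qed
  then show ?thesis using that by (metis order_refl)
qed

lemma total_le: "(\<And>x y c. (x, y, c) \<in> set es \<Longrightarrow> c \<le> K) \<Longrightarrow> total es \<le> length es * K"
proof (induction es)
  case (Cons e es)
  obtain x y c where e: "e = (x, y, c)" by (cases e)
  have "c \<le> K" using Cons.prems by (auto simp: e)
  moreover have "total es \<le> length es * K" by (rule Cons.IH) (use Cons.prems in auto)
  ultimately show ?case by (simp add: e total_def)
qed (simp add: total_def)

text \<open>Positive weights and distinct end points come from the instance, distinct entries and
  the weights from the encoding. Listing each edge in one orientation is harmless, as feasibility is
  symmetric in the end points.\<close>

lemma encodes_wgraph_list:
  assumes inst: "pvc_instance V E w" and enc: "encodes_wgraph (vs, es) V E w"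
  shows "distinct vs" "set vs = V" "wf_edges V es" "length es = card E"
    "(x, y, c) \<in> set es \<Longrightarrow> {x, y} \<in> E \<and> c = w {x, y}"
    "ends ` set es = E"
    "pvc_solvable V E w P \<longleftrightarrow> solvable_list V es P"
proof -
  have map: "map (\<lambda>(x, y). {x, y}) (map (\<lambda>(x, y, c). (x, y)) es) = map ends es"
    by auto
  have enc': "distinct vs" "set vs = V" "distinct (map ends es)" "ends ` set es = E"
    "\<And>x y c. (x, y, c) \<in> set es \<Longrightarrow> c = w {x, y}"
  proof -
    have "encodes_graph (vs, map (\<lambda>(x, y, c). (x, y)) es) V E"
      and w: "\<forall>(x, y, c)\<in>set es. c = w {x, y}"
      using enc by (simp_all add: encodes_wgraph_def)
    then have *: "distinct vs" "set vs = V"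
      "distinct (map (\<lambda>(x, y). {x, y}) (map (\<lambda>(x, y, c). (x, y)) es))"
      "set (map (\<lambda>(x, y). {x, y}) (map (\<lambda>(x, y, c). (x, y)) es)) = E"
      by (simp_all add: encodes_graph_def del: map_map)
    show "distinct vs" "set vs = V" by fact+
    show "distinct (map ends es)" "ends ` set es = E" using *(3,4) unfolding map by simp_all
    show "\<And>x y c. (x, y, c) \<in> set es \<Longrightarrow> c = w {x, y}" using w by blast
  qed
  show "distinct vs" "set vs = V" "ends ` set es = E" by fact+
  have E: "{x, y} \<in> E" if "(x, y, c) \<in> set es" for x y c
    using that enc'(4) by force
  then show "{x, y} \<in> E \<and> c = w {x, y}" if "(x, y, c) \<in> set es"
    using that enc'(5) by blast
  show "length es = card E"
    using enc'(3,4) distinct_card[of "map ends es"] by simp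
  have "x \<in> V \<and> y \<in> V \<and> x \<noteq> y \<and> 0 < c" if "(x, y, c) \<in> set es" for x y c
  proof -
    have "\<exists>u v. u \<in> V \<and> v \<in> V \<and> u \<noteq> v \<and> {x, y} = {u, v}" "0 < w {x, y}"
      using inst E[OF that] unfolding pvc_instance_def simple_graph_def by blast+
    then show ?thesis using enc'(5)[OF that] by (auto simp: doubleton_eq_iff)
  qed
  then show "wf_edges V es" using enc'(3) unfolding wf_edges_def by blast
  have "(\<forall>u v. {u, v} \<in> E \<longrightarrow> real (w {u, v}) \<le> p u \<or> real (w {u, v}) \<le> p v) \<longleftrightarrow>
      (\<forall>(x, y, c)\<in>set es. real c \<le> p x \<or> real c \<le> p y)" for p :: "'a \<Rightarrow> real"
  proof (intro iffI allI impI)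
    fix u v assume *: "\<forall>(x, y, c)\<in>set es. real c \<le> p x \<or> real c \<le> p y" and "{u, v} \<in> E"
    then obtain x y c where xyc: "(x, y, c) \<in> set es" "{u, v} = {x, y}" using enc'(4) by force
    have "real (w {u, v}) \<le> p x \<or> real (w {u, v}) \<le> p y"
      using * xyc(1) enc'(5)[OF xyc(1)] unfolding xyc(2) by blast
    then show "real (w {u, v}) \<le> p u \<or> real (w {u, v}) \<le> p v"
      using xyc(2) by (auto simp: doubleton_eq_iff insert_commute)
  qed (use E enc'(5) in fastforce)
  then show "pvc_solvable V E w P \<longleftrightarrow> solvable_list V es P"
    unfolding pvc_solvable_def pvc_feasible_def solvable_list_def by simp
qed

text \<open>At most \<open>s\<close> edges of weight at most \<open>2 ^ s\<close> have total weight
  at most \<open>2 ^ (2 * s)\<close>, and the absolute value of \<open>P\<close> is below that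
  number; the extra bit accommodates the difference of the two.\<close>

lemma bounded_pvc_size:
  fixes P :: int
  assumes inst: "pvc_instance V E w" and enc: "encodes_wgraph (vs, es) V E w"
  defines "s \<equiv> pvc_size V E w P"
  shows "bounded (2 * s + 1) es P"
proof -
  define z :: nat where "z = 2 ^ (2 * s)"
  have z: "(2::nat) ^ (2 * s + 1) = 2 * z" "(2::int) ^ (2 * s + 1) = 2 * int z"
    by (simp_all add: z_def)
  note enc' = encodes_wgraph_list[OF inst enc]
  have "c \<le> 2 ^ s" if "(x, y, c) \<in> set es" for x y c
  proof -
    have E: "{x, y} \<in> E" "c = w {x, y}" using enc'(5)[OF that] by auto
    have "finite E" using enc'(6) by blast
    then have "bits (w {x, y}) \<le> (\<Sum>e\<in>E. bits (w e))"
      by (intro member_le_sum E) auto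
    then have "(2::nat) ^ bits c \<le> 2 ^ s"
      unfolding s_def pvc_size_def by (intro power_increasing) (auto simp: E)
    then show ?thesis using less_two_power_bits[of c] by linarith
  qed
  then have "total es \<le> length es * 2 ^ s" by (rule total_le)
  also have "\<dots> \<le> 2 ^ s * 2 ^ s"
  proof (rule mult_right_mono)
    have "length es \<le> s" by (simp add: enc'(4) s_def pvc_size_def)
    also have "s < 2 ^ s" by (rule less_exp)
    finally show "length es \<le> 2 ^ s" by simp
  qed simp
  finally have tot: "total es \<le> z" by (simp add: z_def mult_2 power_add)
  have "nat \<bar>P\<bar> < 2 ^ ibits P" by (rule less_two_power_bits)
  also have "(2::nat) ^ ibits P \<le> 2 ^ (2 * s)"
    unfolding s_def pvc_size_def by (intro power_increasing) auto
  finally have "nat \<bar>P\<bar> < z" by (simp add: z_def)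
  with tot show ?thesis
    unfolding bounded_def z by linarith
qed

text \<open>For negative \<open>P\<close> the exponent \<open>nat P\<close> is \<open>0\<close>: the
  budget stays negative under reductions, and the first call answers without branching.\<close>

theorem theorem6:
  fixes vc :: "'a vc_algorithm"
    and pick_reduction :: "('a \<times> 'a \<times> nat \<times> nat) list \<Rightarrow> 'a \<times> 'a \<times> nat \<times> nat"
    and pick_fork :: "('a \<times> 'a \<times> 'a) list \<Rightarrow> 'a \<times> 'a \<times> 'a"
  assumes "decides_vc vc"
    and "vc_time_Ostar 1.274 vc"
    and "valid_pick pick_reduction"
    and "valid_pick pick_fork"
  shows "\<exists>q :: real poly. \<forall>V E w P G.
    pvc_instance V E w \<longrightarrow> encodes_wgraph G V E w \<longrightarrow>
    (\<exists>ans t. pvc_branching vc pick_reduction pick_fork G P = Some (ans, t) \<and>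
       (ans \<longleftrightarrow> pvc_solvable V E w P) \<and>
       real t \<le> poly q (real (pvc_size V E w P)) * 1.274 ^ nat P)"
proof -
  obtain q where q: "\<And>V E G k. simple_graph V E \<Longrightarrow> encodes_graph G V E \<Longrightarrow>
      real (snd (vc G k)) \<le> poly q (real (vc_size V E k)) * 1.274 ^ k"
    using assms(2) unfolding vc_time_Ostar_def by blast
  obtain r where r: "\<And>x y. 0 \<le> x \<Longrightarrow> x \<le> y \<Longrightarrow> poly q x \<le> poly r y"
      "\<And>y. 0 \<le> y \<Longrightarrow> 0 \<le> poly r y"
    using poly_bound_monotone[of q] by blast
  \<comment> \<open>Everything becomes a polynomial in the size \<open>s\<close>: there are at most
    \<open>s\<close> vertices and at most \<open>s\<close> edges, numbers have at most
    \<open>2 * s + 1\<close> bits, and so the input of the subroutine has size at most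
    \<open>4 * s + 1\<close>.\<close>
  define n :: "real poly" where "n = [:0, 1:]"
  define b :: "real poly" where "b = [:1, 2:]"
  define A where "A = pcompose r [:1, 4:]"
  define N where "N = (n + 1) * ([:7:] + [:4:] * b + [:7:] * n + n * ([:3:] + [:2:] * b + n * ([:5:] + [:2:] * b)))
    + [:25:] + [:20:] * n + [:8:] * b + [:4:] * n * b + [:7:] * n * n"
  \<comment> \<open>The shift by \<open>4\<close> in the exponent of \<open>growth\<close> turns
    into the constant factor \<open>1.274 ^ 4\<close>.\<close>
  define R where "R = [:100 * 1.274 ^ 4:] * (N + A)"
  have N: "poly N s = node_cost s (2 * s + 1)" for s
    by (simp add: N_def n_def b_def node_cost_def round_cost_def algebra_simps)
  have A: "poly A s = poly r (4 * s + 1)" for s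
    by (simp add: A_def poly_pcompose algebra_simps)
  show ?thesis
  proof (intro exI[of _ R] allI impI)
    fix V :: "'a set" and E w P G
    assume inst: "pvc_instance V E w" and enc: "encodes_wgraph G V E w"
    obtain vs es where G: "G = (vs, es)" by (cases G)
    define s where "s = pvc_size V E w P"
    note enc' = encodes_wgraph_list[OF inst enc[unfolded G]]
    have time: "real (snd (vc G' k)) \<le> poly A s * 1.274 ^ k"
      if "simple_graph V' E'" "encodes_graph G' V' E'" "length (fst G') \<le> s" "length (snd G') \<le> s"
        "bits k \<le> 2 * s + 1" for V' E' G' k
    proof -
      have "card V' = length (fst G')" "card E' \<le> length (snd G')"
        using that(2) card_image_le[of "set (snd G')" "\<lambda>(u, v). {u, v}"] card_length[of "snd G'"]
        by (auto simp: encodes_graph_def distinct_card split: prod.splits)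
      then have "vc_size V' E' k \<le> 4 * s + 1" using that(3-5) by (simp add: vc_size_def)
      then have "poly q (real (vc_size V' E' k)) \<le> poly A s" unfolding A by (intro r(1)) auto
      then have "poly q (real (vc_size V' E' k)) * 1.274 ^ k \<le> poly A s * 1.274 ^ k"
        by (rule mult_right_mono) simp
      with q[OF that(1,2), of k] show ?thesis by linarith
    qed
    have "runs_within (pvc_branching vc pick_reduction pick_fork (vs, es) P)
        (100 * (node_cost s (2 * s + 1 :: nat) + poly A s) * growth P)
        (\<lambda>ans. ans \<longleftrightarrow> solvable_list (set vs) es P)"
    proof (rule runs_within_pvc_branching[OF assms(1) time _ assms(3,4)])
      show "0 \<le> poly A s" unfolding A by (rule r(2)) simp
      show "wf_edges (set vs) es" "distinct vs" using enc' by simp_all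
      show "bounded (2 * s + 1) es P" unfolding s_def by (rule bounded_pvc_size[OF inst enc[unfolded G]])
      show "length vs \<le> s" "length es \<le> s"
        using enc' distinct_card[of vs] by (simp_all add: s_def pvc_size_def)
    qed
    moreover have "100 * (node_cost s (2 * s + 1 :: nat) + poly A s) * growth P \<le> poly R s * 1.274 ^ nat P"
    proof -
      have "growth P \<le> 1.274 ^ (nat P + 4)"
        unfolding growth_def by (rule power_increasing) auto
      moreover have "0 \<le> 100 * (node_cost s (2 * s + 1 :: nat) + poly A s)"
        unfolding A by (intro mult_nonneg_nonneg add_nonneg_nonneg r(2)) (auto simp: node_cost_def round_cost_def)
      ultimately have "100 * (node_cost s (2 * s + 1 :: nat) + poly A s) * growth P \<le>
          100 * (node_cost s (2 * s + 1 :: nat) + poly A s) * 1.274 ^ (nat P + 4)"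
        by (rule mult_left_mono)
      also have "\<dots> = poly R s * 1.274 ^ nat P"
        by (simp add: R_def N power_add add.commute)
      finally show ?thesis .
    qed
    ultimately show "\<exists>ans t. pvc_branching vc pick_reduction pick_fork G P = Some (ans, t) \<and>
       (ans \<longleftrightarrow> pvc_solvable V E w P) \<and>
       real t \<le> poly R (real (pvc_size V E w P)) * 1.274 ^ nat P"
      unfolding G runs_within_def s_def using enc' by fastforce
  qed
qed

end
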